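(* Suppose $K$ satisfies (K1) and (K2). Let $E$ be an open subset of $\mathbb R^d$ which is a strict minimizer for $\mathrm{Per}_K$ in the cube $Q_R$, $R\ge1$, i.e. $\mathrm{Per}_K(E;Q_R)<+\infty$ and $\mathrm{Per}_K(E;Q_R)<\mathrm{Per}_K(F;Q_R)$ for every measurable $F\subseteq\mathbb R^d$ with $F\setminus Q_R=E\setminus Q_R$ and $F\ne E$. Let $\{\varepsilon_n\}_{n\in\mathbb N}\subset(0,1)$ with $\varepsilon_n\to0$. Then for every $n\in\mathbb N$ there exists a minimizer $u^{(n)}$ for $H^{(\varepsilon_n)}$ in the discrete cube $\{i\in\mathbb Z^d:|i|_\infty\le\lceil R/\varepsilon_n\rceil\}$ such that, denoting by $\bar u^{(n)}:=\bar u^{(n)}_{\varepsilon_n}$ its extension to $\mathbb R^d$, one has $\bar u^{(n_k)}\to\chi_E-\chi_{\mathbb R^d\setminus E}$ a.e. in $\mathbb R^d$ as $k\to+\infty$, for some diverging sequence $\{n_k\}_{k\in\mathbb N}$ of natural numbers.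
   Context: $d\ge2$; $|\cdot|$ is the $\ell^1$ norm on $\mathbb R^d$, $|x|_\infty=\max_n|x_n|$. For $x\in\mathbb R^d$, $r>0$, $Q_r(x):=\{y\in\mathbb R^d:|y-x|_\infty\le r\}$ (closed cube), $Q_r:=Q_r(0)$, $\mathring Q_r(x)$ its interior. $K:\mathbb R^d\times\mathbb R^d\to[0,+\infty]$ is measurable and satisfies (K1) $K(x,y)=K(y,x)$ a.e.; (K2) $\lambda|x-y|^{-d-s}\le K(x,y)\le\Lambda|x-y|^{-d-s}$ a.e., for some $s\in(0,1)$, $\Lambda\ge\lambda>0$. $L_K(A,B):=\int_A\int_BK(x,y)\,dx\,dy$; $\mathrm{Per}_K(E;\Omega):=L_K(E\cap\Omega,\Omega\setminus E)+L_K(E\cap\Omega,\mathbb R^d\setminus(E\cup\Omega))+L_K(E\setminus\Omega,\Omega\setminus E)$. For $\varepsilon>0$ and $i,j\in\mathbb Z^d$: $J^{(\varepsilon)}_{ij}:=\varepsilon^{-d+s}\int_{Q_{\varepsilon/2}(\varepsilon i)}\int_{Q_{\varepsilon/2}(\varepsilon j)}K(x,y)\,dx\,dy$ if $i\ne j$, $J^{(\varepsilon)}_{ii}:=0$. A configuration is $u:\mathbb Z^d\to\{-1,1\}$. For finite $\Gamma\subset\mathbb Z^d$, $H^{(\varepsilon)}_\Gamma(u):=\sum_{(i,j)\in\mathbb Z^{2d}\setminus(\mathbb Z^d\setminus\Gamma)^2}J^{(\varepsilon)}_{ij}(1-u_iu_j)$; $u$ is a minimizer for $H^{(\varepsilon)}$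 in $\Gamma$ if $H^{(\varepsilon)}_\Gamma(u)\le H^{(\varepsilon)}_\Gamma(v)$ for all configurations $v$ agreeing with $u$ outside $\Gamma$. The extension $\bar u_\varepsilon:\mathbb R^d\to\{-1,1\}$ of $u$ is defined a.e. by $\bar u_\varepsilon(x):=u_i$ where $i$ is the unique site with $x\in\mathring Q_{\varepsilon/2}(\varepsilon i)$. *)

theory Defs
  imports "HOL-Analysis.Analysis"
begin

definition l1norm :: "real ^ 'd \<Rightarrow> real" where
  "l1norm x = (\<Sum>n\<in>UNIV. \<bar>x $ n\<bar>)"

definition cube :: "real ^ 'd \<Rightarrow> real \<Rightarrow> (real ^ 'd) set" where
  "cube x r = {y. \<forall>n. \<bar>y $ n - x $ n\<bar> \<le> r}"

definition open_cube :: "real ^ 'd \<Rightarrow> real \<Rightarrow> (real ^ 'd) set" where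
  "open_cube x r = {y. \<forall>n. \<bar>y $ n - x $ n\<bar> < r}"

definition site :: "real \<Rightarrow> int ^ 'd \<Rightarrow> real ^ 'd" where
  "site eps i = (\<chi> n. eps * real_of_int (i $ n))"

definition kernel_ok ::
  "(real ^ 'd \<Rightarrow> real ^ 'd \<Rightarrow> ennreal) \<Rightarrow> real \<Rightarrow> real \<Rightarrow> real \<Rightarrow> bool" where
  "kernel_ok K s lam Lam \<longleftrightarrow>
     0 < s \<and> s < 1 \<and> 0 < lam \<and> lam \<le> Lam \<and>
     (\<lambda>p. K (fst p) (snd p)) \<in> borel_measurable (completion (lborel \<Otimes>\<^sub>M lborel)) \<and>
     (AE p in completion (lborel \<Otimes>\<^sub>M lborel). K (fst p) (snd p) = K (snd p) (fst p)) \<and>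
     (AE p in completion (lborel \<Otimes>\<^sub>M lborel).
        ennreal (lam * l1norm (fst p - snd p) powr (- (real CARD('d) + s))) \<le> K (fst p) (snd p) \<and>
        K (fst p) (snd p) \<le> ennreal (Lam * l1norm (fst p - snd p) powr (- (real CARD('d) + s))))"

definition L_K :: "(real ^ 'd \<Rightarrow> real ^ 'd \<Rightarrow> ennreal) \<Rightarrow> (real ^ 'd) set \<Rightarrow> (real ^ 'd) set \<Rightarrow> ennreal" where
  "L_K K A B = (\<integral>\<^sup>+ x. (\<integral>\<^sup>+ y. K x y * indicator B y \<partial>lebesgue) * indicator A x \<partial>lebesgue)"

definition Per_K :: "(real ^ 'd \<Rightarrow> real ^ 'd \<Rightarrow> ennreal) \<Rightarrow> (real ^ 'd) set \<Rightarrow> (real ^ 'd) set \<Rightarrow> ennreal" where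
  "Per_K K E \<Omega> = L_K K (E \<inter> \<Omega>) (\<Omega> - E) + L_K K (E \<inter> \<Omega>) (UNIV - (E \<union> \<Omega>))
                  + L_K K (E - \<Omega>) (\<Omega> - E)"

text \<open>Strict minimizer of Per_K in \<Omega>; competitors are identified up to Lebesgue-null sets.\<close>
definition strict_minimizer :: "(real ^ 'd \<Rightarrow> real ^ 'd \<Rightarrow> ennreal) \<Rightarrow> (real ^ 'd) set \<Rightarrow> (real ^ 'd) set \<Rightarrow> bool" where
  "strict_minimizer K E \<Omega> \<longleftrightarrow> Per_K K E \<Omega> < \<infinity> \<and>
     (\<forall>F. F \<in> sets lebesgue \<longrightarrow> F - \<Omega> = E - \<Omega> \<longrightarrow>
          emeasure lebesgue ((F - E) \<union> (E - F)) \<noteq> 0 \<longrightarrow> Per_K K E \<Omega> < Per_K K F \<Omega>)"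

definition J_coef :: "(real ^ 'd \<Rightarrow> real ^ 'd \<Rightarrow> ennreal) \<Rightarrow> real \<Rightarrow> real \<Rightarrow> int ^ 'd \<Rightarrow> int ^ 'd \<Rightarrow> ennreal" where
  "J_coef K s eps i j = (if i = j then 0 else
     ennreal (eps powr (s - real CARD('d))) *
       L_K K (cube (site eps i) (eps / 2)) (cube (site eps j) (eps / 2)))"

definition configuration :: "(int ^ 'd \<Rightarrow> int) \<Rightarrow> bool" where
  "configuration u \<longleftrightarrow> (\<forall>i. u i = -1 \<or> u i = 1)"

definition H_energy :: "(real ^ 'd \<Rightarrow> real ^ 'd \<Rightarrow> ennreal) \<Rightarrow> real \<Rightarrow> real \<Rightarrow> (int ^ 'd) set \<Rightarrow> (int ^ 'd \<Rightarrow> int) \<Rightarrow> ennreal" where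
  "H_energy K s eps \<Gamma> u =
     (\<Sum>\<^sub>\<infinity> p \<in> UNIV - ((UNIV - \<Gamma>) \<times> (UNIV - \<Gamma>)).
        J_coef K s eps (fst p) (snd p) * ennreal (real_of_int (1 - u (fst p) * u (snd p))))"

definition is_minimizer :: "(real ^ 'd \<Rightarrow> real ^ 'd \<Rightarrow> ennreal) \<Rightarrow> real \<Rightarrow> real \<Rightarrow> (int ^ 'd) set \<Rightarrow> (int ^ 'd \<Rightarrow> int) \<Rightarrow> bool" where
  "is_minimizer K s eps \<Gamma> u \<longleftrightarrow> configuration u \<and>
     (\<forall>v. configuration v \<longrightarrow> (\<forall>i. i \<notin> \<Gamma> \<longrightarrow> v i = u i) \<longrightarrow>
          H_energy K s eps \<Gamma> u \<le> H_energy K s eps \<Gamma> v)"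

text \<open>Piecewise-constant extension; defined a.e. (value 1 on the null set of cube faces).\<close>
definition extension :: "real \<Rightarrow> (int ^ 'd \<Rightarrow> int) \<Rightarrow> real ^ 'd \<Rightarrow> int" where
  "extension eps u x = (if \<exists>i. x \<in> open_cube (site eps i) (eps / 2)
      then u (THE i. x \<in> open_cube (site eps i) (eps / 2)) else 1)"

definition discrete_cube :: "real \<Rightarrow> real \<Rightarrow> (int ^ 'd) set" where
  "discrete_cube R eps = {i. \<forall>n. \<bar>i $ n\<bar> \<le> \<lceil>R / eps\<rceil>}"

end

theory Submission
  imports Defs
begin

text \<open>
  Let \<open>\<nu>\<close> be the measure on pairs with density the kernel, and let \<open>crossing Q F\<close> be the set of pairs
  that meet \<open>Q\<close> and are separated by \<open>F\<close>; its \<open>\<nu>\<close>-measure is twice the nonlocal perimeter of \<open>F\<close> in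
  \<open>Q\<close>. A configuration is a union of lattice cells, and its energy is a multiple of the \<open>\<nu>\<close>-measure of a
  crossing set for a slightly larger cube. The cells in the excess layer contribute only
  \<open>O(e powr (1 - s))\<close>.

  Letting each cell inside the cube follow the majority of \<open>E\<close> gives lattice sets that converge to \<open>E\<close> and
  whose perimeters do not exceed that of \<open>E\<close> in the limit: close to the diagonal the majority rule
  loses only a constant factor against a quantity that is small anyway, and away from the diagonal
  dominated convergence applies. Taking these sets as boundary data, discrete minimizers are
  asymptotically minimal for the continuous problem.

  Convergence needs no compactness. The perimeter is submodular, hence so is its excess over the
  minimum; along a subsequence with summable excess the lower and the upper limit of the sets
  therefore both have minimal perimeter, and by strict minimality both agree with \<open>E\<close> almost everywhere.
\<close>

text \<open>The perimeter controls \<open>E\<close> only through pairs that meet the cube; outside,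
  \<open>E\<close> is an arbitrary open set. Inside, the part of a cell misjudged by the majority
  rule is at most a multiple of \<open>e powr s\<close> times the interaction across
  \<open>E\<close> within that cell, so the total error is \<open>O(e powr s)\<close> and becomes
  summable along a subsequence. Outside, openness alone yields pointwise convergence, without any
  rate; this suffices because the pairs joining the cube to its complement have finite
  \<nu>-measure, so that dominated convergence applies. A discrete minimizer is not an admissible
  competitor for \<open>E\<close>, since its exterior data are only close to \<open>E\<close>.
  Overwriting them by \<open>E\<close> alters only pairs between the cube and the exterior mismatch,
  whose \<nu>-measure tends to 0. Hence there are two extractions: one makes \<open>e powr s\<close>
  summable for Borel-Cantelli, the other makes the excess summable. Since (K1) and (K2) hold only
  almost everywhere, \<open>K\<close> is exchanged for a Borel kernel that satisfies them
  everywhere.\<close>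

section \<open>Cubes, thin slabs and the l1 norm\<close>

lemma emeasure_lborel_cbox_cart:
  fixes a b :: "real ^ 'd"
  assumes "\<And>n. a $ n \<le> b $ n"
  shows "emeasure lborel (cbox a b) = ennreal (\<Prod>n\<in>UNIV. b $ n - a $ n)"
proof -
  have "cbox a b \<noteq> {}"
    using assms by (simp add: interval_ne_empty_cart)
  then have "measure lborel (cbox a b) = (\<Prod>n\<in>UNIV. b $ n - a $ n)"
    by (rule content_cbox_cart)
  moreover have "emeasure lborel (cbox a b) = ennreal (measure lborel (cbox a b))"
    using emeasure_lborel_cbox_finite[of a b] by (intro emeasure_eq_ennreal_measure) auto
  ultimately show ?thesis
    by simp
qed

lemma cube_eq_cbox: "cube a r = cbox (\<chi> n. a $ n - r) (\<chi> n. a $ n + r)"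
proof -
  have *: "\<bar>y - x\<bar> \<le> r \<longleftrightarrow> x - r \<le> y \<and> y \<le> x + r" for x y :: real
    by linarith
  show ?thesis by (rule set_eqI) (simp only: cube_def mem_box_cart mem_Collect_eq vec_lambda_beta *)
qed

lemma open_cube_eq_box: "open_cube a r = box (\<chi> n. a $ n - r) (\<chi> n. a $ n + r)"
proof -
  have *: "\<bar>y - x\<bar> < r \<longleftrightarrow> x - r < y \<and> y < x + r" for x y :: real
    by linarith
  show ?thesis by (rule set_eqI) (simp only: open_cube_def mem_box_cart mem_Collect_eq vec_lambda_beta *)
qed

lemma emeasure_cube:
  fixes a :: "real ^ 'd"
  assumes "0 \<le> r"
  shows "emeasure lborel (cube a r) = ennreal ((2 * r) ^ CARD('d))"
  unfolding cube_eq_cbox using assms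
  by (subst emeasure_lborel_cbox_cart) (auto simp: algebra_simps)

lemma emeasure_open_cube: "emeasure lborel (open_cube a r) = emeasure lborel (cube a r)"
  unfolding cube_eq_cbox open_cube_eq_box
  by (simp add: emeasure_lborel_box_eq emeasure_lborel_cbox_eq)

lemma closed_cube: "closed (cube a r)"
  unfolding cube_eq_cbox by (rule closed_cbox)

lemma open_open_cube: "open (open_cube a r)"
  unfolding open_cube_eq_box by (rule open_box)

lemma cube_borel [measurable]: "cube a r \<in> sets borel"
  by (simp add: borel_closed closed_cube)

lemma open_cube_borel [measurable]: "open_cube a r \<in> sets borel"
  by (simp add: borel_open open_open_cube)

lemma cube_minus_open_cube_null: "cube a r - open_cube a r \<in> null_sets lborel"
proof -
  have "emeasure lborel (cube a r) < \<infinity>"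
    unfolding cube_eq_cbox by (rule emeasure_lborel_cbox_finite)
  moreover have "open_cube a r \<subseteq> cube a r"
    by (auto simp: open_cube_def cube_def less_imp_le)
  ultimately have "emeasure lborel (cube a r - open_cube a r) = 0"
    by (subst emeasure_Diff) (auto simp: emeasure_open_cube)
  then show ?thesis by (simp add: null_sets_def)
qed

lemma emeasure_slab_le:
  fixes a :: "real ^ 'd"
  assumes "0 \<le> r" "l \<le> h"
  shows "emeasure lborel {x \<in> cube a r. l \<le> x $ m \<and> x $ m \<le> h} \<le> ennreal ((h - l) * (2 * r) ^ (CARD('d) - 1))"
proof -
  let ?a = "\<chi> n. if n = m then l else a $ n - r" and ?b = "\<chi> n. if n = m then h else a $ n + r"
  have "{x \<in> cube a r. l \<le> x $ m \<and> x $ m \<le> h} \<subseteq> cbox ?a ?b"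
    by (auto simp: cube_eq_cbox mem_box_cart)
  then have "emeasure lborel {x \<in> cube a r. l \<le> x $ m \<and> x $ m \<le> h} \<le> emeasure lborel (cbox ?a ?b)"
    by (intro emeasure_mono) auto
  also have "\<dots> = ennreal (\<Prod>n\<in>UNIV. if n = m then h - l else 2 * r)"
    using assms by (subst emeasure_lborel_cbox_cart) (auto intro!: arg_cong[where f=ennreal] prod.cong)
  also have "(\<Prod>n\<in>UNIV. if n = m then h - l else 2 * r) = (h - l) * (2 * r) ^ (CARD('d) - 1)"
    by (subst prod.remove[of _ m]) (auto simp: card_Diff_singleton)
  finally show ?thesis .
qed

lemma l1norm_nonneg: "0 \<le> l1norm x"
  unfolding l1norm_def by (simp add: sum_nonneg)

lemma l1norm_minus_commute: "l1norm (x - y) = l1norm (y - x)"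
  unfolding l1norm_def by (simp add: abs_minus_commute)

lemma abs_component_le_l1norm: "\<bar>x $ n\<bar> \<le> l1norm x"
  unfolding l1norm_def by (rule member_le_sum) auto

lemma l1norm_le_card:
  fixes x :: "real ^ 'd"
  assumes "\<And>n. \<bar>x $ n\<bar> \<le> c"
  shows "l1norm x \<le> real CARD('d) * c"
  using sum_bounded_above[of UNIV "\<lambda>n. \<bar>x $ n\<bar>" c] assms by (simp add: l1norm_def)

lemma l1norm_triangle: "l1norm (x - z) \<le> l1norm (x - y) + l1norm (y - z)"
  unfolding l1norm_def sum.distrib[symmetric] by (intro sum_mono) auto

lemma l1norm_eq_0: "l1norm x = 0 \<longleftrightarrow> x = 0"
  unfolding l1norm_def by (simp add: sum_nonneg_eq_0_iff vec_eq_iff)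

lemma continuous_on_l1norm [continuous_intros]:
  "continuous_on S f \<Longrightarrow> continuous_on S (\<lambda>x. l1norm (f x))"
  unfolding l1norm_def by (intro continuous_intros)

lemma borel_measurable_l1norm [measurable]: "l1norm \<in> borel_measurable borel"
  by (intro borel_measurable_continuous_onI continuous_intros)

lemma emeasure_lborel_Times:
  fixes A :: "'a::euclidean_space set" and B :: "'b::euclidean_space set"
  assumes "A \<in> sets borel" "B \<in> sets borel"
  shows "emeasure lborel (A \<times> B) = emeasure lborel A * emeasure lborel B"
  using assms by (simp add: lborel_prod[symmetric] lborel.emeasure_pair_measure_Times)

section \<open>Limits and unordered sums of measures of sets\<close>

text \<open>Fatou's lemma for sets: \<open>D\<close> lies in the lower limit of the
  \<open>A n\<close>. It serves as lower semicontinuity of the perimeter under pointwise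
  convergence.\<close>

lemma emeasure_le_if_eventually_mem:
  assumes D: "D \<in> sets M" "\<And>n. A n \<in> sets M"
    and ev: "\<And>x. x \<in> D \<Longrightarrow> eventually (\<lambda>n. x \<in> A n) sequentially"
    and le: "\<And>n. emeasure M (A n) \<le> c"
  shows "emeasure M D \<le> c"
proof -
  let ?B = "\<lambda>m. D \<inter> (\<Inter>n\<in>{m..}. A n)"
  have B: "?B m \<in> sets M" for m
    using D by (intro sets.Int sets.countable_INT') auto
  have "\<exists>m. \<forall>n\<in>{m..}. x \<in> A n" if "x \<in> D" for x
    using ev[OF that] by (simp add: eventually_sequentially Ball_def)
  then have "D = (\<Union>m. ?B m)"
    by (intro equalityI subsetI) auto
  moreover have "(SUP m. emeasure M (?B m)) = emeasure M (\<Union>m. ?B m)"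
    using B by (intro SUP_emeasure_incseq) (auto intro!: monoI INF_superset_mono)
  moreover have "emeasure M (?B m) \<le> c" for m
    using D by (intro order_trans[OF emeasure_mono le[of m]]) auto
  ultimately show ?thesis
    by (metis SUP_least)
qed

text \<open>Dominated convergence for indicators, with \<open>Z\<close> as the dominating
  set.\<close>

lemma emeasure_tendsto_0_if_eventually_not_mem:
  assumes Z: "Z \<in> sets M" "emeasure M Z < \<infinity>" and A: "\<And>n. A n \<in> sets M" "\<And>n. A n \<subseteq> Z"
    and ev: "AE x in M. eventually (\<lambda>n. x \<notin> A n) sequentially"
  shows "(\<lambda>n. emeasure M (A n)) \<longlonglongrightarrow> 0"
proof -
  have "(\<lambda>n. \<integral>\<^sup>+x. indicator (A n) x \<partial>M) \<longlonglongrightarrow> (\<integral>\<^sup>+x. 0 \<partial>M)"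
  proof (rule nn_integral_dominated_convergence)
    show "AE x in M. (\<lambda>n. indicator (A n) x :: ennreal) \<longlonglongrightarrow> 0"
      using ev
    proof eventually_elim
      case (elim x)
      then show ?case
        by (intro tendsto_eventually) (auto elim!: eventually_mono)
    qed
    show "(\<integral>\<^sup>+x. indicator Z x \<partial>M) < \<infinity>"
      using Z by simp
  qed (use A Z in \<open>auto split: split_indicator\<close>)
  then show ?thesis
    using A by simp
qed

text \<open>\<open>H_energy\<close> is an unordered sum over pairs of sites, so countable additivity
  is needed for \<open>infsum\<close>. With nonnegative terms \<open>infsum\<close> is the supremum
  of the finite partial sums, and the finite sets \<open>?J n\<close>, cut out by an enumeration,
  exhaust \<open>I\<close>.\<close>

lemma emeasure_UN_eq_infsum:
  assumes I: "countable I" and X: "\<And>i. i \<in> I \<Longrightarrow> X i \<in> sets M" and disj: "disjoint_family_on X I"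
  shows "emeasure M (\<Union>i\<in>I. X i) = (\<Sum>\<^sub>\<infinity>i\<in>I. emeasure M (X i))"
proof (rule antisym)
  let ?J = "\<lambda>n. {i \<in> I. to_nat_on I i < n}"
  have fin: "finite (?J n)" for n
  proof (rule finite_imageD)
    show "finite (to_nat_on I ` ?J n)"
      by (rule finite_subset[of _ "{..<n}"]) auto
    show "inj_on (to_nat_on I) (?J n)"
      using inj_on_to_nat_on[OF I] by (rule inj_on_subset) auto
  qed
  have sum: "emeasure M (\<Union>i\<in>J. X i) = (\<Sum>i\<in>J. emeasure M (X i))" if "finite J" "J \<subseteq> I" for J
    using that X disjoint_family_on_mono[OF that(2) disj] by (intro sum_emeasure[symmetric]) auto
  have inf: "(\<Sum>\<^sub>\<infinity>i\<in>I. emeasure M (X i)) = (SUP J\<in>{J. finite J \<and> J \<subseteq> I}. \<Sum>i\<in>J. emeasure M (X i))"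
    using nonneg_infsum_complete[of I "\<lambda>i. emeasure M (X i)"] by simp
  have "(\<Union>i\<in>I. X i) = (\<Union>n. \<Union>i\<in>?J n. X i)"
    by blast
  also have "emeasure M \<dots> = (SUP n. emeasure M (\<Union>i\<in>?J n. X i))"
  proof (rule SUP_emeasure_incseq[symmetric])
    show "range (\<lambda>n. \<Union>i\<in>?J n. X i) \<subseteq> sets M"
      using X fin by (auto intro!: sets.finite_UN)
    show "incseq (\<lambda>n. \<Union>i\<in>?J n. X i)"
      by (auto simp: incseq_def)
  qed
  also have "\<dots> \<le> (\<Sum>\<^sub>\<infinity>i\<in>I. emeasure M (X i))"
  proof (rule SUP_least)
    fix n
    have "emeasure M (\<Union>i\<in>?J n. X i) = (\<Sum>i\<in>?J n. emeasure M (X i))"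
      by (rule sum) (use fin in auto)
    also have "\<dots> \<le> (\<Sum>\<^sub>\<infinity>i\<in>I. emeasure M (X i))"
      unfolding inf by (rule SUP_upper) (use fin in auto)
    finally show "emeasure M (\<Union>i\<in>?J n. X i) \<le> (\<Sum>\<^sub>\<infinity>i\<in>I. emeasure M (X i))" .
  qed
  finally show "emeasure M (\<Union>i\<in>I. X i) \<le> (\<Sum>\<^sub>\<infinity>i\<in>I. emeasure M (X i))" .
  show "(\<Sum>\<^sub>\<infinity>i\<in>I. emeasure M (X i)) \<le> emeasure M (\<Union>i\<in>I. X i)"
    unfolding inf
  proof (rule SUP_least)
    fix J assume J: "J \<in> {J. finite J \<and> J \<subseteq> I}"
    then have "(\<Sum>i\<in>J. emeasure M (X i)) = emeasure M (\<Union>i\<in>J. X i)"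
      by (intro sum[symmetric]) auto
    also have "\<dots> \<le> emeasure M (\<Union>i\<in>I. X i)"
      using X J I by (intro emeasure_mono UN_mono sets.countable_UN') auto
    finally show "(\<Sum>i\<in>J. emeasure M (X i)) \<le> emeasure M (\<Union>i\<in>I. X i)" .
  qed
qed

section \<open>Nonlocal perimeters\<close>

definition crossing :: "'a set \<Rightarrow> 'a set \<Rightarrow> ('a \<times> 'a) set" where
  "crossing Q F = {(x, y). (x \<in> Q \<or> y \<in> Q) \<and> (x \<in> F) \<noteq> (y \<in> F)}"

lemma crossing_eq: "crossing Q F = (F \<times> (- F) \<union> (- F) \<times> F) - (- Q) \<times> (- Q)"
  by (auto simp: crossing_def)

lemma crossing_borel [measurable]:
  fixes F Q :: "'a::euclidean_space set"
  assumes "F \<in> sets borel" "Q \<in> sets borel"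
  shows "crossing Q F \<in> sets borel"
  using assms unfolding crossing_eq by (intro sets.Diff sets.Un borel_Times) auto

lemma crossing_cong:
  "(fst p \<in> A \<longleftrightarrow> fst p \<in> B) \<Longrightarrow> (snd p \<in> A \<longleftrightarrow> snd p \<in> B) \<Longrightarrow> p \<in> crossing Q A \<longleftrightarrow> p \<in> crossing Q B"
  by (cases p) (simp add: crossing_def)

lemma crossing_Compl: "crossing Q (- F) = crossing Q F"
  by (auto simp: crossing_def)

text \<open>The inequality already holds between the indicators at each pair. It is strict only for
  pairs meeting \<open>Q\<close> with one point in \<open>A - B\<close> and the other in
  \<open>B - A\<close>: the right side counts them twice, the left side not at all.\<close>

lemma emeasure_crossing_submodular:
  fixes A B Q :: "'a::euclidean_space set"
  assumes M: "sets M = sets borel" and "A \<in> sets borel" "B \<in> sets borel" "Q \<in> sets borel"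
  shows "emeasure M (crossing Q (A \<inter> B)) + emeasure M (crossing Q (A \<union> B))
    \<le> emeasure M (crossing Q A) + emeasure M (crossing Q B)"
proof -
  have [measurable]: "crossing Q (A \<inter> B) \<in> sets M" "crossing Q (A \<union> B) \<in> sets M" "crossing Q A \<in> sets M" "crossing Q B \<in> sets M"
    unfolding M using assms by (auto intro!: crossing_borel)
  have "emeasure M (crossing Q (A \<inter> B)) + emeasure M (crossing Q (A \<union> B))
      = (\<integral>\<^sup>+p. indicator (crossing Q (A \<inter> B)) p + indicator (crossing Q (A \<union> B)) p \<partial>M)"
    by (simp add: nn_integral_add)
  also have "\<dots> \<le> (\<integral>\<^sup>+p. indicator (crossing Q A) p + indicator (crossing Q B) p \<partial>M)"
    by (intro nn_integral_mono) (auto simp: crossing_def split: split_indicator)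
  also have "\<dots> = emeasure M (crossing Q A) + emeasure M (crossing Q B)"
    by (simp add: nn_integral_add)
  finally show ?thesis .
qed

text \<open>By submodularity the excess over the minimum is subadditive under intersections, so a
  summable excess survives the passage to infinite intersections, and hence to the lower limit.
  This replaces a compactness argument.\<close>

lemma near_minimizers_liminf:
  fixes E Q :: "'a::euclidean_space set"
  assumes M: "sets M = sets borel"
    and E: "E \<in> sets borel" and Q: "Q \<in> sets borel" and fin: "emeasure M (crossing Q E) < \<infinity>"
    and min: "\<And>F. F \<in> sets borel \<Longrightarrow> F - Q = E - Q \<Longrightarrow> emeasure M (crossing Q E) \<le> emeasure M (crossing Q F)"
    and strict: "\<And>F. F \<in> sets borel \<Longrightarrow> F - Q = E - Q \<Longrightarrow> emeasure M (crossing Q F) \<le> emeasure M (crossing Q E)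
        \<Longrightarrow> AE x in lborel. x \<in> F \<longleftrightarrow> x \<in> E"
    and F: "\<And>k. F k \<in> sets borel" "\<And>k. F k - Q = E - Q"
    and near: "\<And>k. emeasure M (crossing Q (F k)) \<le> emeasure M (crossing Q E) + ennreal ((1/2) ^ k)"
  shows "AE x in lborel. x \<in> E \<longrightarrow> eventually (\<lambda>k. x \<in> F k) sequentially"
proof -
  let ?P = "\<lambda>F. emeasure M (crossing Q F)"
  let ?I = "\<lambda>n m. \<Inter>k\<in>{n..n+m}. F k"
  let ?G = "\<lambda>n. \<Inter>k\<in>{n..}. F k"
  let ?L = "\<Union>n. ?G n"
  have cutM: "crossing Q A \<in> sets M" if "A \<in> sets borel" for A
    unfolding M using that Q by (rule crossing_borel)
  have I: "?I n m \<in> sets borel" for n m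
    using F(1) by (intro sets.countable_INT') auto
  have G: "?G n \<in> sets borel" for n
    using F(1) by (intro sets.countable_INT') auto
  have Fmem: "x \<in> F k \<longleftrightarrow> x \<in> E" if "x \<notin> Q" for x k
    using F(2)[of k] that by blast
  have Isuc: "?I n (Suc m) = ?I n m \<inter> F (n + Suc m)" for n m
    by (simp add: atLeastAtMostSuc_conv Int_commute)
  \<comment> \<open>The excess is the geometric sum of \<open>(1/2) ^ k\<close> for k from n to n +
    m, in closed form.\<close>
  have PI: "?P (?I n m) \<le> ?P E + ennreal (2 * (1/2) ^ n - (1/2) ^ (n + m))" for n m
  proof (induction m)
    case 0
    then show ?case using near[of n] by simp
  next
    case (Suc m)
    let ?U = "?I n m \<union> F (n + Suc m)"
    have nn: "0 \<le> 2 * (1/2 :: real) ^ n - (1/2) ^ (n + m)"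
    proof -
      have "(1/2 :: real) ^ (n + m) \<le> (1/2) ^ n" by (intro power_decreasing) auto
      moreover have "0 \<le> (1/2 :: real) ^ n" by simp
      ultimately show ?thesis by linarith
    qed
    \<comment> \<open>An empty intersection would be the whole space; nonemptiness of the index
      range makes \<open>?I n m\<close> agree with \<open>E\<close> outside \<open>Q\<close>, so
      that \<open>?U\<close> is a competitor.\<close>
    have "\<exists>k. k \<in> {n..n + m}"
      by (rule exI[of _ n]) auto
    then have "?U - Q = E - Q"
      using Fmem by auto
    then have "?P E \<le> ?P ?U"
      using I F(1) by (intro min) auto
    then have "?P (?I n (Suc m)) + ?P E \<le> ?P (?I n (Suc m)) + ?P ?U"
      by (intro add_mono) auto
    also have "\<dots> \<le> ?P (?I n m) + ?P (F (n + Suc m))"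
      unfolding Isuc using I F(1) Q by (intro emeasure_crossing_submodular M) auto
    also have "\<dots> \<le> (?P E + ennreal (2 * (1/2) ^ n - (1/2) ^ (n + m))) + (?P E + ennreal ((1/2) ^ (n + Suc m)))"
      by (intro add_mono Suc near)
    also have "\<dots> = (?P E + (ennreal (2 * (1/2) ^ n - (1/2) ^ (n + m)) + ennreal ((1/2) ^ (n + Suc m)))) + ?P E"
      by (simp add: algebra_simps)
    also have "ennreal (2 * (1/2) ^ n - (1/2) ^ (n + m)) + ennreal ((1/2) ^ (n + Suc m))
        = ennreal (2 * (1/2) ^ n - (1/2) ^ (n + Suc m))"
      using nn by (subst ennreal_plus[symmetric]) auto
    \<comment> \<open>One copy of the perimeter of \<open>E\<close> is cancelled on both sides,
      which its finiteness permits.\<close>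
    finally show ?case
      using fin by (simp add: ennreal_add_left_cancel_le add.commute[of _ "?P E"] less_top[symmetric])
  qed
  have PG: "?P (?G n) \<le> ?P E + ennreal (2 * (1/2) ^ n)" for n
  proof (rule emeasure_le_if_eventually_mem[where A = "\<lambda>m. crossing Q (?I n m)"])
    show "?P (?I n m) \<le> ?P E + ennreal (2 * (1/2) ^ n)" for m
      by (rule order_trans[OF PI]) (intro add_mono ennreal_leI order_refl, simp)
    have ev: "eventually (\<lambda>m. x \<in> ?I n m \<longleftrightarrow> x \<in> ?G n) sequentially" for x
    proof (cases "x \<in> ?G n")
      case False
      then obtain k where k: "k \<ge> n" "x \<notin> F k" by auto
      have "x \<notin> ?I n m" if "m \<ge> k" for m
        using k that by auto
      then show ?thesis
        using False unfolding eventually_sequentially by blast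
    qed auto
    fix p assume p: "p \<in> crossing Q (?G n)"
    show "eventually (\<lambda>m. p \<in> crossing Q (?I n m)) sequentially"
      using ev[of "fst p"] ev[of "snd p"]
    proof eventually_elim
      case (elim m)
      show ?case
        using p by (simp only: crossing_cong[OF elim])
    qed
  qed (use cutM I G in auto)
  have L: "?L \<in> sets borel" using G by auto
  have Gmono: "?G n \<subseteq> ?G m" if "n \<le> m" for n m
    using that by (intro INF_superset_mono) auto
  \<comment> \<open>The lower limit \<open>?L\<close> depends only on the tails
    \<open>?G (n + m)\<close>, so it inherits the bound for every n; letting n grow leaves no
    excess.\<close>
  have PL: "?P ?L \<le> ?P E + ennreal (2 * (1/2) ^ n)" for n
  proof (rule emeasure_le_if_eventually_mem[where A = "\<lambda>m. crossing Q (?G (n + m))"])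
    show "?P (?G (n + m)) \<le> ?P E + ennreal (2 * (1/2) ^ n)" for m
      by (rule order_trans[OF PG]) (intro add_mono ennreal_leI order_refl mult_left_mono power_decreasing, auto)
    have ev: "eventually (\<lambda>m. x \<in> ?G (n + m) \<longleftrightarrow> x \<in> ?L) sequentially" for x
    proof (cases "x \<in> ?L")
      case True
      then obtain k where k: "x \<in> ?G k" by auto
      have "x \<in> ?G (n + m)" if "m \<ge> k" for m
        using k Gmono[of k "n + m"] that by auto
      then show ?thesis
        using True unfolding eventually_sequentially by blast
    next
      case False
      then show ?thesis
        by (intro always_eventually allI) blast
    qed
    fix p assume p: "p \<in> crossing Q ?L"
    show "eventually (\<lambda>m. p \<in> crossing Q (?G (n + m))) sequentially"
      using ev[of "fst p"] ev[of "snd p"]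
    proof eventually_elim
      case (elim m)
      show ?case
        using p by (simp only: crossing_cong[OF elim])
    qed
  qed (use cutM L G in auto)
  have "(\<lambda>n. ?P E + ennreal (2 * (1/2) ^ n)) \<longlonglongrightarrow> ?P E + ennreal (2 * 0)"
    by (intro tendsto_add tendsto_const tendsto_ennrealI tendsto_mult LIMSEQ_power_zero) auto
  then have "?P ?L \<le> ?P E"
    using PL by (intro LIMSEQ_le_const[where X = "\<lambda>n. ?P E + ennreal (2 * (1/2) ^ n)"]) auto
  moreover have "?L - Q = E - Q"
    using Fmem by auto
  ultimately have "AE x in lborel. x \<in> ?L \<longleftrightarrow> x \<in> E"
    using L by (intro strict) auto
  then show ?thesis
    by eventually_elim (auto simp: eventually_sequentially)
qed

text \<open>Complementation preserves \<open>crossing\<close>, so the result on lower limits,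
  applied to \<open>- F k\<close> and \<open>- E\<close>, also controls the upper limit.\<close>

lemma near_minimizers_converge:
  fixes E Q :: "'a::euclidean_space set"
  assumes M: "sets M = sets borel"
    and E: "E \<in> sets borel" and Q: "Q \<in> sets borel" and fin: "emeasure M (crossing Q E) < \<infinity>"
    and min: "\<And>F. F \<in> sets borel \<Longrightarrow> F - Q = E - Q \<Longrightarrow> emeasure M (crossing Q E) \<le> emeasure M (crossing Q F)"
    and strict: "\<And>F. F \<in> sets borel \<Longrightarrow> F - Q = E - Q \<Longrightarrow> emeasure M (crossing Q F) \<le> emeasure M (crossing Q E)
        \<Longrightarrow> AE x in lborel. x \<in> F \<longleftrightarrow> x \<in> E"
    and F: "\<And>k. F k \<in> sets borel" "\<And>k. F k - Q = E - Q"
    and near: "\<And>k. emeasure M (crossing Q (F k)) \<le> emeasure M (crossing Q E) + ennreal ((1/2) ^ k)"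
  shows "AE x in lborel. eventually (\<lambda>k. x \<in> F k \<longleftrightarrow> x \<in> E) sequentially"
proof -
  have 1: "AE x in lborel. x \<in> E \<longrightarrow> eventually (\<lambda>k. x \<in> F k) sequentially"
    by (rule near_minimizers_liminf[OF assms])
  have "AE x in lborel. x \<in> - E \<longrightarrow> eventually (\<lambda>k. x \<in> - F k) sequentially"
  proof (rule near_minimizers_liminf[OF M _ Q])
    fix A assume A: "A \<in> sets borel" "A - Q = - E - Q"
    then have "- A \<in> sets borel" "- A - Q = E - Q" by auto
    note * = min[OF this] strict[OF this]
    show "emeasure M (crossing Q (- E)) \<le> emeasure M (crossing Q A)"
      using *(1) by (simp add: crossing_Compl)
    show "AE x in lborel. x \<in> A \<longleftrightarrow> x \<in> - E" if "emeasure M (crossing Q A) \<le> emeasure M (crossing Q (- E))"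
      using *(2) that by (simp add: crossing_Compl) (auto elim: eventually_mono)
  next
    show "- F k - Q = - E - Q" for k
      using F(2)[of k] by auto
  qed (use E fin F near in \<open>auto simp: crossing_Compl\<close>)
  with 1 show ?thesis
  proof eventually_elim
    case (elim x)
    then show ?case
      by (cases "x \<in> E") (auto elim: eventually_mono)
  qed
qed

section \<open>Fractional kernels\<close>

text \<open>With \<open>dyadic_upper\<close>, this puts every positive distance into a shell between
  \<open>t / 2\<close> and \<open>t\<close>, where \<open>t\<close> is \<open>r / 2 ^ k\<close> or
  \<open>r * 2 ^ Suc k\<close>. The index is one less than the least exponent that passes the
  distance.\<close>

lemma dyadic_lower:
  fixes t r :: real
  assumes "0 < t" "t < r"
  obtains k :: nat where "r / 2 ^ k / 2 \<le> t" "t < r / 2 ^ k"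
proof -
  obtain n where "(1/2::real) ^ n < t / r"
    using real_arch_pow_inv[of "t / r" "1/2"] assms by auto
  then have ex: "\<exists>n. r / 2 ^ n \<le> t"
    using assms by (intro exI[of _ n]) (auto simp: field_simps power_divide less_imp_le)
  define m where "m = (LEAST n. r / 2 ^ n \<le> t)"
  have m: "r / 2 ^ m \<le> t"
    unfolding m_def by (rule LeastI_ex[OF ex])
  then obtain k where k: "m = Suc k"
    using assms by (cases m) auto
  then have "\<not> r / 2 ^ k \<le> t"
    using not_less_Least[of k "\<lambda>n. r / 2 ^ n \<le> t"] unfolding m_def by simp
  with m k show ?thesis
    by (intro that[of k]) (auto simp: field_simps)
qed

lemma dyadic_upper:
  fixes t r :: real
  assumes "0 < r" "r \<le> t"
  obtains k :: nat where "r * 2 ^ Suc k / 2 \<le> t" "t < r * 2 ^ Suc k"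
proof -
  obtain n where "t / r < 2 ^ n"
    using real_arch_pow[of 2 "t / r"] by auto
  then have ex: "\<exists>n. t < r * 2 ^ n"
    using assms by (intro exI[of _ n]) (auto simp: field_simps)
  define m where "m = (LEAST n. t < r * 2 ^ n)"
  have m: "t < r * 2 ^ m"
    unfolding m_def by (rule LeastI_ex[OF ex])
  then obtain k where k: "m = Suc k"
    using assms by (cases m) auto
  then have "\<not> t < r * 2 ^ k"
    using not_less_Least[of k "\<lambda>n. t < r * 2 ^ n"] unfolding m_def by simp
  with m k show ?thesis
    by (intro that[of k]) (auto simp: field_simps)
qed

text \<open>Symmetry and bounds are demanded at every pair, which spares exceptional sets in all
  estimates. On the diagonal both bounds are 0 because \<open>0 powr a = 0\<close>, hence the
  assumption \<open>x \<noteq> y\<close> in \<open>k_ge_of_near\<close>.\<close>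

locale fractional_kernel =
  fixes k :: "(real ^ 'd) \<times> (real ^ 'd) \<Rightarrow> ennreal" and s lam Lam :: real
  assumes k_measurable [measurable]: "k \<in> borel_measurable borel"
    and s: "0 < s" "s < 1" and lam: "0 < lam" "lam \<le> Lam"
    and k_sym: "k (x, y) = k (y, x)"
    and k_lower: "ennreal (lam * l1norm (x - y) powr (- (real CARD('d) + s))) \<le> k (x, y)"
    and k_upper: "k (x, y) \<le> ennreal (Lam * l1norm (x - y) powr (- (real CARD('d) + s)))"
begin

definition \<nu> :: "((real ^ 'd) \<times> (real ^ 'd)) measure" where
  "\<nu> = density lborel k"

lemma sets_\<nu> [measurable_cong, simp]: "sets \<nu> = sets borel"
  by (simp add: \<nu>_def)

lemma space_\<nu> [simp]: "space \<nu> = UNIV"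
  by (simp add: \<nu>_def)

lemma \<nu>_le:
  assumes "A \<in> sets borel" "\<And>p. p \<in> A \<Longrightarrow> k p \<le> c"
  shows "emeasure \<nu> A \<le> c * emeasure lborel A"
proof -
  have "emeasure \<nu> A = (\<integral>\<^sup>+p. k p * indicator A p \<partial>lborel)"
    unfolding \<nu>_def using assms(1) by (intro emeasure_density) auto
  also have "\<dots> \<le> (\<integral>\<^sup>+p. c * indicator A p \<partial>lborel)"
    using assms(2) by (intro nn_integral_mono) (auto split: split_indicator)
  finally show ?thesis
    using assms(1) by (simp add: nn_integral_cmult_indicator)
qed

lemma \<nu>_ge:
  assumes "A \<in> sets borel" "\<And>p. p \<in> A \<Longrightarrow> c \<le> k p"
  shows "c * emeasure lborel A \<le> emeasure \<nu> A"
proof -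
  have "c * emeasure lborel A = (\<integral>\<^sup>+p. c * indicator A p \<partial>lborel)"
    using assms(1) by (simp add: nn_integral_cmult_indicator)
  also have "\<dots> \<le> (\<integral>\<^sup>+p. k p * indicator A p \<partial>lborel)"
    using assms(2) by (intro nn_integral_mono) (auto split: split_indicator)
  also have "\<dots> = emeasure \<nu> A"
    unfolding \<nu>_def using assms(1) by (intro emeasure_density[symmetric]) auto
  finally show ?thesis .
qed

text \<open>A null set \<open>N\<close> makes \<open>N \<times> UNIV\<close> and
  \<open>UNIV \<times> N\<close> null, and \<nu> has a density with respect to Lebesgue measure.
  This transfers pointwise convergence of sets to pairs.\<close>

lemma AE_\<nu>:
  assumes "AE x in lborel. P x"
  shows "AE p in \<nu>. P (fst p) \<and> P (snd p)"
proof -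
  obtain N where N: "\<And>x. x \<in> space lborel - N \<Longrightarrow> P x" and "N \<in> null_sets lborel"
    using AE_E3[OF assms] by blast
  have N_mem: "x \<in> N" if "\<not> P x" for x
    using N[of x] that by auto
  have [measurable]: "N \<in> sets borel" and N0: "emeasure lborel N = 0"
    using \<open>N \<in> null_sets lborel\<close> by auto
  have "(N \<times> UNIV) \<union> (UNIV \<times> N) \<in> null_sets (lborel :: ((real ^ 'd) \<times> (real ^ 'd)) measure)"
    by (intro null_sets.Un) (auto simp: null_sets_def emeasure_lborel_Times N0 intro!: borel_Times)
  then have "AE p in lborel. P (fst p) \<and> P (snd p)"
    by (rule AE_I') (use N_mem in auto)
  then show ?thesis
    unfolding \<nu>_def by (subst AE_density) auto
qed

lemma emeasure_\<nu>_swap: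
  assumes A: "A \<in> sets borel"
  shows "emeasure \<nu> ((\<lambda>p. (snd p, fst p)) -` A) = emeasure \<nu> A"
proof -
  have A': "(\<lambda>p. (snd p, fst p)) -` A \<in> sets borel"
  proof -
    have "(\<lambda>p :: (real ^ 'd) \<times> (real ^ 'd). (snd p, fst p)) \<in> borel \<rightarrow>\<^sub>M borel"
      by (intro borel_measurable_continuous_onI continuous_intros)
    from measurable_sets[OF this A] show ?thesis by simp
  qed
  have "emeasure \<nu> A = (\<integral>\<^sup>+p. k p * indicator A p \<partial>(lborel \<Otimes>\<^sub>M lborel))"
    unfolding \<nu>_def lborel_prod using A by (intro emeasure_density) auto
  also have "\<dots> = (\<integral>\<^sup>+y. \<integral>\<^sup>+x. k (x, y) * indicator A (x, y) \<partial>lborel \<partial>lborel)"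
    using A by (subst lborel_pair.nn_integral_snd[symmetric]) (auto simp: borel_prod lborel_prod)
  also have "\<dots> = (\<integral>\<^sup>+y. \<integral>\<^sup>+x. k (y, x) * indicator ((\<lambda>p. (snd p, fst p)) -` A) (y, x) \<partial>lborel \<partial>lborel)"
    by (auto intro!: nn_integral_cong simp: k_sym split: split_indicator)
  also have "\<dots> = (\<integral>\<^sup>+p. k p * indicator ((\<lambda>p. (snd p, fst p)) -` A) p \<partial>(lborel \<Otimes>\<^sub>M lborel))"
    using A' by (subst lborel.nn_integral_fst[symmetric]) (auto simp: borel_prod lborel_prod)
  also have "\<dots> = emeasure \<nu> ((\<lambda>p. (snd p, fst p)) -` A)"
    unfolding \<nu>_def lborel_prod using A' by (intro emeasure_density[symmetric]) auto
  finally show ?thesis by simp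
qed

lemma emeasure_\<nu>_Times_commute:
  assumes "A \<in> sets borel" "B \<in> sets borel"
  shows "emeasure \<nu> (A \<times> B) = emeasure \<nu> (B \<times> A)"
proof -
  have "(\<lambda>p. (snd p, fst p)) -` (A \<times> B) = B \<times> A" by auto
  then show ?thesis
    using emeasure_\<nu>_swap[of "A \<times> B"] assms by (simp add: borel_Times)
qed

lemma k_le_of_far:
  assumes "0 < t" "t \<le> l1norm (x - y)"
  shows "k (x, y) \<le> ennreal (Lam * t powr (- (real CARD('d) + s)))"
  by (rule order_trans[OF k_upper])
     (use assms lam s in \<open>auto intro!: ennreal_leI mult_left_mono powr_mono2'\<close>)

lemma k_ge_of_near:
  assumes "x \<noteq> y" "l1norm (x - y) \<le> t"
  shows "ennreal (lam * t powr (- (real CARD('d) + s))) \<le> k (x, y)"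
proof (rule order_trans[OF _ k_lower])
  have "0 < l1norm (x - y)"
    using assms l1norm_nonneg[of "x - y"] l1norm_eq_0[of "x - y"] by auto
  then show "ennreal (lam * t powr (- (real CARD('d) + s))) \<le> ennreal (lam * l1norm (x - y) powr (- (real CARD('d) + s)))"
    using assms lam s by (auto intro!: ennreal_leI mult_left_mono powr_mono2')
qed

lemma shell_measurable [measurable]:
  "{(x, y). x \<in> A \<and> a \<le> l1norm (x - y) \<and> l1norm (x - y) < b} \<in> sets borel" if [measurable]: "A \<in> sets borel"
  for A :: "(real ^ 'd) set"
proof -
  have "{(x, y). x \<in> A \<and> a \<le> l1norm (x - y) \<and> l1norm (x - y) < b}
      = (A \<times> UNIV) \<inter> {p. a \<le> l1norm (fst p - snd p)} \<inter> {p. l1norm (fst p - snd p) < b}"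
    by auto
  also have "\<dots> \<in> sets borel"
  proof (intro sets.Int)
    show "{p :: (real ^ 'd) \<times> (real ^ 'd). a \<le> l1norm (fst p - snd p)} \<in> sets borel"
      by (intro borel_closed closed_Collect_le continuous_intros)
    show "{p :: (real ^ 'd) \<times> (real ^ 'd). l1norm (fst p - snd p) < b} \<in> sets borel"
      by (intro borel_open open_Collect_less continuous_intros)
  qed (auto intro: borel_Times)
  finally show ?thesis .
qed

text \<open>On the shell \<open>k\<close> is at most \<open>Lam * (t / 2) powr (- (d + s))\<close>
  with d the dimension, and the fibre over each \<open>x\<close> lies in a cube of side
  \<open>2 * t\<close>. The powers of 2 from both facts combine to
  \<open>2 powr (2 * d + s)\<close>, the powers of \<open>t\<close> to
  \<open>t powr (- s)\<close>.\<close>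

lemma \<nu>_shell_le:
  fixes A :: "(real ^ 'd) set"
  assumes [measurable]: "A \<in> sets borel" and t: "0 < t"
  shows "emeasure \<nu> {(x, y). x \<in> A \<and> t / 2 \<le> l1norm (x - y) \<and> l1norm (x - y) < t}
    \<le> ennreal (Lam * 2 powr (2 * real CARD('d) + s) * t powr (- s)) * emeasure lborel A" (is "emeasure \<nu> ?S \<le> _")
proof -
  let ?T = "{(x, y). x \<in> A \<and> 0 \<le> l1norm (x - y) \<and> l1norm (x - y) < t}"
  have S: "?S \<in> sets borel" and T: "?T \<in> sets borel"
    by measurable
  have "emeasure \<nu> ?S \<le> ennreal (Lam * (t / 2) powr (- (real CARD('d) + s))) * emeasure lborel ?S"
    using t k_le_of_far[of "t / 2"] by (intro \<nu>_le S) auto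
  also have "\<dots> \<le> ennreal (Lam * (t / 2) powr (- (real CARD('d) + s))) * emeasure lborel ?T"
    using S T by (intro mult_left_mono emeasure_mono) (auto simp: l1norm_nonneg)
  also have "emeasure lborel ?T = (\<integral>\<^sup>+x. \<integral>\<^sup>+y. indicator ?T (x, y) \<partial>lborel \<partial>lborel)"
    unfolding lborel_prod[symmetric]
    by (intro lborel.emeasure_pair_measure) (use T in \<open>simp only: lborel_prod sets_lborel\<close>)
  also have "\<dots> \<le> (\<integral>\<^sup>+x. \<integral>\<^sup>+y. indicator A x * indicator (cube x t) y \<partial>lborel \<partial>lborel)"
  proof (intro nn_integral_mono)
    fix x y :: "real ^ 'd"
    have "y \<in> cube x t" if "l1norm (x - y) < t"
    proof -
      have "\<bar>y $ n - x $ n\<bar> \<le> t" for n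
        using abs_component_le_l1norm[of "x - y" n] that by simp
      then show ?thesis by (simp add: cube_def)
    qed
    then show "indicator ?T (x, y) \<le> (indicator A x * indicator (cube x t) y :: ennreal)"
      by (auto split: split_indicator)
  qed
  also have "\<dots> = (\<integral>\<^sup>+x. ennreal ((2 * t) ^ CARD('d)) * indicator A x \<partial>lborel)"
    using t by (intro nn_integral_cong) (simp add: nn_integral_cmult emeasure_cube mult.commute)
  also have "\<dots> = ennreal ((2 * t) ^ CARD('d)) * emeasure lborel A"
    by (simp add: nn_integral_cmult_indicator)
  finally have "emeasure \<nu> ?S
      \<le> ennreal (Lam * (t / 2) powr (- (real CARD('d) + s))) * (ennreal ((2 * t) ^ CARD('d)) * emeasure lborel A)"
    by (simp add: mult_left_mono)
  also have "\<dots> = ennreal (Lam * (t / 2) powr (- (real CARD('d) + s)) * (2 * t) ^ CARD('d)) * emeasure lborel A"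
    using lam t by (subst ennreal_mult) (auto simp: mult.assoc)
  also have "Lam * (t / 2) powr (- (real CARD('d) + s)) * (2 * t) ^ CARD('d)
      = Lam * 2 powr (2 * real CARD('d) + s) * t powr (- s)"
    using t by (simp add: powr_realpow[symmetric] powr_mult powr_divide powr_minus powr_add powr_diff field_simps)
      (simp add: powr_add[symmetric] mult.commute)
  finally show ?thesis .
qed

lemma emeasure_boundary_layer_le:
  fixes a :: "real ^ 'd"
  assumes "0 \<le> r" "0 \<le> t"
  shows "emeasure lborel {x \<in> cube a r. \<exists>n. a $ n + r - t \<le> x $ n \<or> x $ n \<le> a $ n - r + t}
    \<le> ennreal (2 * real CARD('d) * t * (2 * r) ^ (CARD('d) - 1))"
proof -
  let ?A = "\<lambda>n. {x \<in> cube a r. a $ n + r - t \<le> x $ n \<and> x $ n \<le> a $ n + r}"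
  let ?B = "\<lambda>n. {x \<in> cube a r. a $ n - r \<le> x $ n \<and> x $ n \<le> a $ n - r + t}"
  let ?c = "ennreal (t * (2 * r) ^ (CARD('d) - 1))"
  have [measurable]: "?A n \<in> sets borel" "?B n \<in> sets borel" for n
    unfolding Collect_conj_eq Collect_mem_eq
    by (intro sets.Int borel_closed closed_cube closed_Collect_le continuous_intros)+
  have AB: "emeasure lborel (?A n \<union> ?B n) \<le> ?c + ?c" for n
    using assms emeasure_slab_le[of r "a $ n + r - t" "a $ n + r" a n] emeasure_slab_le[of r "a $ n - r" "a $ n - r + t" a n]
    by (intro order_trans[OF emeasure_subadditive] add_mono) auto
  have "x \<in> (\<Union>n\<in>UNIV. ?A n \<union> ?B n)"
    if x: "x \<in> {x \<in> cube a r. \<exists>n. a $ n + r - t \<le> x $ n \<or> x $ n \<le> a $ n - r + t}" for x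
  proof -
    obtain n where n: "a $ n + r - t \<le> x $ n \<or> x $ n \<le> a $ n - r + t" using x by blast
    have "\<bar>x $ n - a $ n\<bar> \<le> r" "x \<in> cube a r" using x by (auto simp: cube_def)
    with n have "x \<in> ?A n \<union> ?B n" by auto
    then show ?thesis by blast
  qed
  then have "emeasure lborel {x \<in> cube a r. \<exists>n. a $ n + r - t \<le> x $ n \<or> x $ n \<le> a $ n - r + t}
      \<le> emeasure lborel (\<Union>n\<in>UNIV. ?A n \<union> ?B n)"
    by (intro emeasure_mono subsetI) auto
  also have "\<dots> \<le> (\<Sum>n\<in>UNIV. emeasure lborel (?A n \<union> ?B n))"
    by (intro emeasure_subadditive_finite) auto
  also have "\<dots> \<le> (\<Sum>n\<in>(UNIV :: 'd set). ?c + ?c)"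
    by (intro sum_mono AB)
  also have "\<dots> = ennreal (2 * real CARD('d) * t * (2 * r) ^ (CARD('d) - 1))"
    using assms by (simp add: ennreal_plus[symmetric] ennreal_of_nat_eq_real_of_nat ennreal_mult[symmetric] del: ennreal_plus)
  finally show ?thesis .
qed

lemma boundary_layer_borel [measurable]:
  fixes a :: "real ^ 'd"
  shows "{x \<in> cube a r. \<exists>n. a $ n + r - t \<le> x $ n \<or> x $ n \<le> a $ n - r + t} \<in> sets borel"
proof -
  have "{x \<in> cube a r. \<exists>n. a $ n + r - t \<le> x $ n \<or> x $ n \<le> a $ n - r + t}
      = cube a r \<inter> (\<Union>n\<in>UNIV. {x. a $ n + r - t \<le> x $ n} \<union> {x. x $ n \<le> a $ n - r + t})"
    by auto
  also have "\<dots> \<in> sets borel"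
    by (intro borel_closed closed_Int closed_cube closed_UN ballI closed_Un closed_Collect_le continuous_intros) auto
  finally show ?thesis .
qed

text \<open>Pairs are sorted by dyadic distance. At distance about t < r the inner point lies within
  t of a face, in a layer of volume of order \<open>t * r ^ (d - 1)\<close>, so the shell
  contributes about \<open>t powr (1 - s) * r ^ (d - 1)\<close>: a geometric series with ratio
  \<open>q < 1\<close>, as s < 1. At distance t \<ge> r the whole cube is used and the shell
  contributes about \<open>t powr (- s) * r ^ d\<close>, with ratio \<open>p < 1\<close>, as s >
  0.\<close>

lemma \<nu>_cube_Compl_le:
  "\<exists>M\<ge>0. \<forall>a r. 0 < r \<longrightarrow> emeasure \<nu> (cube a r \<times> - cube a r) \<le> ennreal (M * r powr (real CARD('d) - s))"
proof -
  define C where "C = Lam * 2 powr (2 * real CARD('d) + s)"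
  define q p :: real where "q = 2 powr (s - 1)" and "p = 2 powr (- s)"
  define M1 where "M1 = C * 2 * real CARD('d) * 2 ^ (CARD('d) - 1)"
  define M2 where "M2 = C * 2 ^ CARD('d) * p"
  have C: "0 \<le> C" using lam by (auto simp: C_def)
  have q: "0 < q" "q < 1" and p: "0 < p" "p < 1"
    using s powr_less_mono[of "s - 1" 0 "2::real"] powr_less_mono[of "- s" 0 "2::real"] by (auto simp: q_def p_def)
  have M: "0 \<le> M1" "0 \<le> M2"
    using C p by (auto simp: M1_def M2_def)
  have pw: "((2::real) ^ k) powr e = (2 powr e) ^ k" for k e
    by (simp add: powr_realpow[symmetric] powr_powr mult.commute)
  have "emeasure \<nu> (cube a r \<times> - cube a r) \<le> ennreal ((M1 / (1 - q) + M2 / (1 - p)) * r powr (real CARD('d) - s))"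
    if r: "0 < r" for a r
  proof -
    let ?L = "\<lambda>t. {x \<in> cube a r. \<exists>n. a $ n + r - t \<le> x $ n \<or> x $ n \<le> a $ n - r + t}"
    let ?S = "\<lambda>A t. {(x, y). x \<in> A \<and> t / 2 \<le> l1norm (x - y) \<and> l1norm (x - y) < t}"
    define A where "A k = ?S (?L (r / 2 ^ k)) (r / 2 ^ k)" for k :: nat
    define B where "B k = ?S (cube a r) (r * 2 ^ Suc k)" for k :: nat
    have AB [measurable]: "A k \<in> sets borel" "B k \<in> sets borel" for k
      unfolding A_def B_def by (intro shell_measurable boundary_layer_borel cube_borel)+
    \<comment> \<open>The two factorisations match the shapes in which the near and the far shells
      produce powers of \<open>r\<close>.\<close>
    have rd: "r powr (real CARD('d) - s) = r powr (1 - s) * r ^ (CARD('d) - 1)"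
      "r powr (real CARD('d) - s) = r powr (- s) * r ^ CARD('d)"
      using r by (simp_all add: powr_realpow[symmetric] powr_add[symmetric] of_nat_diff)
    have nuA: "emeasure \<nu> (A k) \<le> ennreal (M1 * r powr (real CARD('d) - s) * q ^ k)" for k
    proof -
      define t where "t = r / 2 ^ k"
      have t: "0 < t" using r by (simp add: t_def)
      have "emeasure \<nu> (?S (?L t) t) \<le> ennreal (C * t powr (- s)) * emeasure lborel (?L t)"
        unfolding C_def using t by (intro \<nu>_shell_le) auto
      also have "\<dots> \<le> ennreal (C * t powr (- s)) * ennreal (2 * real CARD('d) * t * (2 * r) ^ (CARD('d) - 1))"
        using r t by (intro mult_left_mono emeasure_boundary_layer_le) auto
      also have "\<dots> = ennreal (C * t powr (- s) * (2 * real CARD('d) * t * (2 * r) ^ (CARD('d) - 1)))"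
        using C r t by (intro ennreal_mult[symmetric]) auto
      also have "C * t powr (- s) * (2 * real CARD('d) * t * (2 * r) ^ (CARD('d) - 1))
          = M1 * (t powr (1 - s) * r ^ (CARD('d) - 1))"
        using t by (simp add: M1_def powr_diff powr_minus field_simps power_mult_distrib)
      also have "t powr (1 - s) = r powr (1 - s) * q ^ k"
        using r by (simp add: t_def powr_divide pw q_def powr_diff field_simps)
      finally show ?thesis
        unfolding t_def rd(1) A_def by (simp add: mult_ac)
    qed
    have nuB: "emeasure \<nu> (B k) \<le> ennreal (M2 * r powr (real CARD('d) - s) * p ^ k)" for k
    proof -
      define t where "t = r * 2 ^ Suc k"
      have t: "0 < t" using r by (simp add: t_def)
      have "emeasure \<nu> (?S (cube a r) t) \<le> ennreal (C * t powr (- s)) * emeasure lborel (cube a r)"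
        unfolding C_def using t by (intro \<nu>_shell_le) auto
      also have "\<dots> = ennreal (C * t powr (- s) * (2 * r) ^ CARD('d))"
        using C r by (simp add: emeasure_cube ennreal_mult)
      also have "t powr (- s) = r powr (- s) * p ^ Suc k"
        using r unfolding t_def by (subst powr_mult) (auto simp only: pw p_def)
      also have "C * (r powr (- s) * p ^ Suc k) * (2 * r) ^ CARD('d)
          = M2 * (r powr (- s) * r ^ CARD('d)) * p ^ k"
        by (simp add: M2_def power_mult_distrib mult_ac)
      finally show ?thesis
        unfolding t_def rd(2) B_def by simp
    qed
    have "cube a r \<times> - cube a r \<subseteq> (\<Union>k. A k) \<union> (\<Union>k. B k)"
    proof clarify
      fix x y assume xy: "x \<in> cube a r" "y \<notin> cube a r" "(x, y) \<notin> (\<Union>k. B k)"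
      then have "x \<noteq> y" by auto
      then have pos: "0 < l1norm (x - y)"
        using l1norm_nonneg[of "x - y"] l1norm_eq_0[of "x - y"] by auto
      have "l1norm (x - y) < r"
      proof (rule ccontr)
        assume "\<not> l1norm (x - y) < r"
        then obtain k where "r * 2 ^ Suc k / 2 \<le> l1norm (x - y)" "l1norm (x - y) < r * 2 ^ Suc k"
          using dyadic_upper[OF r] by (metis linorder_not_less)
        then have "(x, y) \<in> B k" unfolding B_def using xy(1) by blast
        with xy(3) show False by blast
      qed
      with pos obtain k where k: "r / 2 ^ k / 2 \<le> l1norm (x - y)" "l1norm (x - y) < r / 2 ^ k"
        using dyadic_lower by blast
      \<comment> \<open>A coordinate in which \<open>y\<close> leaves the cube forces
        \<open>x\<close>, which is close to \<open>y\<close>, to be close to a face in that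
        coordinate.\<close>
      obtain n where n: "\<bar>y $ n - a $ n\<bar> > r"
        using xy(2) by (auto simp: cube_def not_le)
      have "\<bar>x $ n - y $ n\<bar> < r / 2 ^ k"
        using abs_component_le_l1norm[of "x - y" n] k by simp
      with n have "a $ n + r - r / 2 ^ k \<le> x $ n \<or> x $ n \<le> a $ n - r + r / 2 ^ k"
        by linarith
      then have "(x, y) \<in> A k"
        unfolding A_def using k xy(1) by blast
      then show "(x, y) \<in> (\<Union>k. A k)" by blast
    qed
    then have "emeasure \<nu> (cube a r \<times> - cube a r) \<le> emeasure \<nu> ((\<Union>k. A k) \<union> (\<Union>k. B k))"
      by (intro emeasure_mono) auto
    also have "\<dots> \<le> emeasure \<nu> (\<Union>k. A k) + emeasure \<nu> (\<Union>k. B k)"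
      by (intro emeasure_subadditive) auto
    also have "\<dots> \<le> (\<Sum>k. emeasure \<nu> (A k)) + (\<Sum>k. emeasure \<nu> (B k))"
      by (intro add_mono emeasure_subadditive_countably) auto
    also have "\<dots> \<le> (\<Sum>k. ennreal (M1 * r powr (real CARD('d) - s) * q ^ k))
        + (\<Sum>k. ennreal (M2 * r powr (real CARD('d) - s) * p ^ k))"
      by (intro add_mono suminf_le nuA nuB) auto
    also have "(\<Sum>k. ennreal (M1 * r powr (real CARD('d) - s) * q ^ k))
        = ennreal (M1 * r powr (real CARD('d) - s) * (1 / (1 - q)))"
      using q M by (intro suminf_ennreal_eq sums_mult geometric_sums) auto
    also have "(\<Sum>k. ennreal (M2 * r powr (real CARD('d) - s) * p ^ k))
        = ennreal (M2 * r powr (real CARD('d) - s) * (1 / (1 - p)))"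
      using p M by (intro suminf_ennreal_eq sums_mult geometric_sums) auto
    finally show ?thesis
      using M p q by (simp add: ennreal_plus[symmetric] field_simps del: ennreal_plus)
  qed
  moreover have "0 \<le> M1 / (1 - q) + M2 / (1 - p)"
    using M p q by auto
  ultimately show ?thesis by blast
qed

end

section \<open>Lattice cells\<close>

text \<open>Adding 1/2 before rounding down selects the nearest site. The resulting half-open cells
  partition the space exactly, while differing only by null sets from the closed cubes of
  \<open>J_coef\<close> and the open cubes of \<open>extension\<close>.\<close>

definition cell_index :: "real \<Rightarrow> real ^ 'd \<Rightarrow> int ^ 'd" where
  "cell_index e x = (\<chi> n. \<lfloor>x $ n / e + 1/2\<rfloor>)"

definition cell :: "real \<Rightarrow> int ^ 'd \<Rightarrow> (real ^ 'd) set" where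
  "cell e i = {x. cell_index e x = i}"

lemma mem_cell_iff:
  assumes "0 < e"
  shows "x \<in> cell e i \<longleftrightarrow> (\<forall>n. site e i $ n - e / 2 \<le> x $ n \<and> x $ n < site e i $ n + e / 2)"
proof -
  have "\<lfloor>t / e + 1/2\<rfloor> = j \<longleftrightarrow> e * of_int j - e / 2 \<le> t \<and> t < e * of_int j + e / 2" for t j
    unfolding floor_eq_iff using assms by (auto simp: field_simps)
  then show ?thesis
    by (simp add: cell_def cell_index_def vec_eq_iff site_def)
qed

lemma cell_subset_cube:
  assumes "0 < e"
  shows "cell e i \<subseteq> cube (site e i) (e / 2)"
proof
  fix x assume "x \<in> cell e i"
  have "\<bar>x $ n - site e i $ n\<bar> \<le> e / 2" for n
  proof -
    have "site e i $ n - e / 2 \<le> x $ n \<and> x $ n < site e i $ n + e / 2"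
      using \<open>x \<in> cell e i\<close> unfolding mem_cell_iff[OF assms] by blast
    then show ?thesis by linarith
  qed
  then show "x \<in> cube (site e i) (e / 2)"
    unfolding cube_def by blast
qed

lemma open_cube_subset_cell:
  assumes "0 < e"
  shows "open_cube (site e i) (e / 2) \<subseteq> cell e i"
proof
  fix x assume "x \<in> open_cube (site e i) (e / 2)"
  then have x: "\<bar>x $ n - site e i $ n\<bar> < e / 2" for n
    by (simp only: open_cube_def mem_Collect_eq)
  have "site e i $ n - e / 2 \<le> x $ n \<and> x $ n < site e i $ n + e / 2" for n
    using x[of n] by linarith
  then show "x \<in> cell e i"
    unfolding mem_cell_iff[OF assms] by blast
qed

lemma cell_borel [measurable]:
  fixes i :: "int ^ 'd"
  assumes "0 < e"
  shows "cell e i \<in> sets borel"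
proof -
  have "cell e i = (\<Inter>n. {x. site e i $ n - e / 2 \<le> x $ n} \<inter> {x. x $ n < site e i $ n + e / 2})"
    using assms by (auto simp: mem_cell_iff)
  also have "\<dots> \<in> sets borel"
  proof (intro sets.finite_INT sets.Int)
    show "{x :: real ^ 'd. site e i $ n - e / 2 \<le> x $ n} \<in> sets borel" for n
      by (intro borel_closed closed_Collect_le continuous_intros)
    show "{x :: real ^ 'd. x $ n < site e i $ n + e / 2} \<in> sets borel" for n
      by (intro borel_open open_Collect_less continuous_intros)
  qed auto
  finally show ?thesis .
qed

lemma Collect_cell_index: "{x. P (cell_index e x)} = (\<Union>i\<in>Collect P. cell e i)"
  by (auto simp: cell_def)

lemma Collect_cell_index_borel:
  assumes "0 < e"
  shows "{x :: real ^ 'd. P (cell_index e x)} \<in> sets borel"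
  unfolding Collect_cell_index using assms by (intro sets.countable_UN') auto

lemma cell_disjoint: "i \<noteq> j \<Longrightarrow> cell e i \<inter> cell e j = {}"
  by (auto simp: cell_def)

lemma cube_minus_cell_null:
  assumes "0 < e"
  shows "cube (site e i) (e / 2) - cell e i \<in> null_sets lborel"
  by (rule null_sets_subset[OF cube_minus_open_cube_null])
     (use assms open_cube_subset_cell in auto)

lemma AE_mem_cell_iff:
  assumes "0 < e"
  shows "AE x in lborel. \<forall>i. x \<in> cell e i \<longleftrightarrow> x \<in> cube (site e i) (e / 2)"
  unfolding AE_all_countable
proof
  fix i :: "int ^ 'd"
  show "AE x in lborel. x \<in> cell e i \<longleftrightarrow> x \<in> cube (site e i) (e / 2)"
    by (rule AE_I'[OF cube_minus_cell_null[OF assms, of i]])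
      (use cell_subset_cube[OF assms] in auto)
qed

lemma emeasure_cell:
  fixes i :: "int ^ 'd"
  assumes "0 < e"
  shows "emeasure lborel (cell e i) = ennreal (e ^ CARD('d))"
proof -
  have "emeasure lborel (cell e i) = emeasure lborel (cube (site e i) (e / 2))"
    using AE_mem_cell_iff[OF assms] assms by (intro emeasure_eq_AE) (auto elim: eventually_mono)
  then show ?thesis
    using assms by (simp add: emeasure_cube)
qed

lemma extension_eq:
  assumes "0 < e" "\<exists>i. x \<in> open_cube (site e i) (e / 2)"
  shows "extension e u x = u (cell_index e x)"
proof -
  have "i = cell_index e x" if "x \<in> open_cube (site e i) (e / 2)" for i
    using open_cube_subset_cell[OF assms(1), of i] that by (auto simp: cell_def)
  then have "(THE i. x \<in> open_cube (site e i) (e / 2)) = cell_index e x"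
    using assms(2) by (intro the_equality) auto
  then show ?thesis
    using assms(2) by (simp add: extension_def)
qed

text \<open>The exceptional set consists of cell faces and does not depend on the configuration, so
  the quantifier over \<open>u\<close> may stand inside.\<close>

lemma AE_extension_eq:
  assumes "0 < e"
  shows "AE x in lborel. \<forall>u. extension e u x = u (cell_index e x)"
proof -
  have "AE x in lborel. \<forall>i. x \<notin> cube (site e i) (e / 2) - open_cube (site e i) (e / 2)"
    unfolding AE_all_countable using AE_not_in[OF cube_minus_open_cube_null] by blast
  then show ?thesis
  proof eventually_elim
    case (elim x)
    have "x \<in> cell e (cell_index e x)" by (simp add: cell_def)
    then have "x \<in> open_cube (site e (cell_index e x)) (e / 2)"
      using elim cell_subset_cube[OF assms] by blast
    then show ?case
      using extension_eq[OF assms] by blast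
  qed
qed

lemma finite_discrete_cube: "finite (discrete_cube R e :: (int ^ 'd) set)"
proof -
  let ?c = "\<lceil>R / e\<rceil>"
  have "vec_nth ` (discrete_cube R e :: (int ^ 'd) set) \<subseteq> PiE UNIV (\<lambda>_. {- ?c..?c})"
    by (auto simp: discrete_cube_def abs_le_iff) (smt (verit))+
  moreover have "finite (PiE (UNIV :: 'd set) (\<lambda>_. {- ?c..?c}))"
    by (intro finite_PiE) auto
  ultimately have "finite (vec_nth ` (discrete_cube R e :: (int ^ 'd) set))"
    by (rule finite_subset)
  then show ?thesis
    by (rule finite_imageD) (auto simp: inj_on_def vec_eq_iff)
qed

text \<open>An admissible configuration is determined by the subset of \<open>\<Gamma>\<close> where
  it equals 1. There are thus finitely many, and a least energy exists even if values are
  infinite.\<close>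

lemma minimizer_exists:
  assumes \<Gamma>: "finite \<Gamma>" and v: "configuration v"
  obtains u where "is_minimizer K s e \<Gamma> u" "\<And>i. i \<notin> \<Gamma> \<Longrightarrow> u i = v i"
proof -
  let ?W = "{w. configuration w \<and> (\<forall>i. i \<notin> \<Gamma> \<longrightarrow> w i = v i)}"
  have "inj_on (\<lambda>w. {i \<in> \<Gamma>. w i = 1}) ?W"
  proof (rule inj_onI, rule ext)
    fix w w' i assume w: "w \<in> ?W" "w' \<in> ?W" and eq: "{i \<in> \<Gamma>. w i = 1} = {i \<in> \<Gamma>. w' i = 1}"
    have "w i = -1 \<or> w i = 1" "w' i = -1 \<or> w' i = 1"
      using w by (auto simp: configuration_def)
    then show "w i = w' i"
      using w eq by (cases "i \<in> \<Gamma>") (auto simp: set_eq_iff dest!: spec[of _ i])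
  qed
  moreover have "finite ((\<lambda>w. {i \<in> \<Gamma>. w i = 1}) ` ?W)"
    by (rule finite_subset[of _ "Pow \<Gamma>"]) (use \<Gamma> in auto)
  ultimately have "finite ?W"
    by (rule finite_imageD[rotated])
  moreover have "?W \<noteq> {}" using v by auto
  ultimately obtain u where "is_arg_min (H_energy K s e \<Gamma>) (\<lambda>w. w \<in> ?W) u"
    using ex_is_arg_min_if_finite by blast
  then have u: "u \<in> ?W" "\<And>w. w \<in> ?W \<Longrightarrow> H_energy K s e \<Gamma> u \<le> H_energy K s e \<Gamma> w"
    unfolding is_arg_min_linorder by blast+
  have "is_minimizer K s e \<Gamma> u"
    unfolding is_minimizer_def using u by auto
  with u show ?thesis
    by (intro that[of u]) auto
qed

context fractional_kernel
begin

lemma \<nu>_cube_eq_cell: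
  assumes "0 < e"
  shows "emeasure \<nu> (cube (site e i) (e / 2) \<times> cube (site e j) (e / 2)) = emeasure \<nu> (cell e i \<times> cell e j)"
  using AE_\<nu>[OF AE_mem_cell_iff[OF assms]] assms
  by (intro emeasure_eq_AE) (auto elim: eventually_mono intro!: borel_Times)

lemma \<nu>_cell_Compl_le:
  "\<exists>M\<ge>0. \<forall>e i. 0 < e \<longrightarrow> emeasure \<nu> (cell e i \<times> - cell e i) \<le> ennreal (M * e powr (real CARD('d) - s))"
proof -
  obtain M where M: "0 \<le> M" "\<And>a r. 0 < r \<Longrightarrow> emeasure \<nu> (cube a r \<times> - cube a r) \<le> ennreal (M * r powr (real CARD('d) - s))"
    using \<nu>_cube_Compl_le by blast
  have "emeasure \<nu> (cell e i \<times> - cell e i) \<le> ennreal (M * e powr (real CARD('d) - s))" if e: "0 < e" for e i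
  proof -
    have "emeasure \<nu> (cell e i \<times> - cell e i) = emeasure \<nu> (cube (site e i) (e / 2) \<times> - cube (site e i) (e / 2))"
      using AE_\<nu>[OF AE_mem_cell_iff[OF e]] e
      by (intro emeasure_eq_AE) (auto elim: eventually_mono intro!: borel_Times)
    also have "\<dots> \<le> ennreal (M * (e / 2) powr (real CARD('d) - s))"
      using e by (intro M) auto
    also have "\<dots> \<le> ennreal (M * e powr (real CARD('d) - s))"
    proof -
      have "1 \<le> real CARD('d)" by (simp add: Suc_le_eq)
      then have "0 \<le> real CARD('d) - s"
        using s by linarith
      then show ?thesis
        using M(1) e by (intro ennreal_leI mult_left_mono powr_mono2) auto
    qed
    finally show ?thesis .
  qed
  with M show ?thesis by blast
qed

text \<open>Sites with different spins carry \<open>1 - u i * u j = 2\<close>, whence the factor 2,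
  and the products of their cells tile the crossing set. Sites with equal spins contribute nothing
  to either side.\<close>

lemma H_energy_eq:
  assumes LK: "\<And>A B. A \<in> sets borel \<Longrightarrow> B \<in> sets borel \<Longrightarrow> L_K K A B = emeasure \<nu> (A \<times> B)"
    and e: "0 < e" and u: "configuration u"
  shows "H_energy K s e \<Gamma> u = ennreal (2 * e powr (s - real CARD('d))) *
    emeasure \<nu> (crossing {x. cell_index e x \<in> \<Gamma>} {x. u (cell_index e x) = 1})"
proof -
  let ?c = "ennreal (2 * e powr (s - real CARD('d)))"
  \<comment> \<open>Absorbing the constant into the measure makes every summand the measure of a
    set, as \<open>emeasure_UN_eq_infsum\<close> expects.\<close>
  let ?M = "scale_measure ?c \<nu>"
  let ?I = "UNIV - (UNIV - \<Gamma>) \<times> (UNIV - \<Gamma>)"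
  define X where "X p = (if u (fst p) = u (snd p) then {} else cell e (fst p) \<times> cell e (snd p))" for p
  have u': "u i = -1 \<or> u i = 1" for i
    using u by (simp add: configuration_def)
  have "J_coef K s e (fst p) (snd p) * ennreal (real_of_int (1 - u (fst p) * u (snd p))) = emeasure ?M (X p)" for p
  proof (cases "u (fst p) = u (snd p)")
    case True
    then have "u (fst p) * u (snd p) = 1"
      using u'[of "snd p"] by auto
    with True show ?thesis by (simp add: X_def)
  next
    case False
    then have "u (fst p) * u (snd p) = - 1" "fst p \<noteq> snd p"
      using u'[of "snd p"] u'[of "fst p"] by auto
    then show ?thesis
      using False by (simp add: X_def J_coef_def LK \<nu>_cube_eq_cell[OF e] ennreal_mult mult_ac)
  qed
  then have "H_energy K s e \<Gamma> u = (\<Sum>\<^sub>\<infinity>p\<in>?I. emeasure ?M (X p))"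
    by (simp add: H_energy_def)
  also have "\<dots> = emeasure ?M (\<Union>p\<in>?I. X p)"
  proof (rule emeasure_UN_eq_infsum[symmetric])
    show "X p \<in> sets ?M" for p
      using e by (auto simp: X_def intro!: borel_Times)
    show "disjoint_family_on X ?I"
      by (auto simp: X_def disjoint_family_on_def cell_def split: if_splits)
  qed auto
  also have "(\<Union>p\<in>?I. X p) = crossing {x. cell_index e x \<in> \<Gamma>} {x. u (cell_index e x) = 1}"
  proof (intro set_eqI)
    fix q :: "(real ^ 'd) \<times> (real ^ 'd)"
    have "q \<in> X p \<longleftrightarrow> p = (cell_index e (fst q), cell_index e (snd q)) \<and> u (fst p) \<noteq> u (snd p)" for p
      by (cases p; cases q) (auto simp: X_def cell_def)
    then show "q \<in> (\<Union>p\<in>?I. X p) \<longleftrightarrow> q \<in> crossing {x. cell_index e x \<in> \<Gamma>} {x. u (cell_index e x) = 1}"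
      using u'[of "cell_index e (fst q)"] u'[of "cell_index e (snd q)"]
      by (cases q) (auto simp: crossing_def)
  qed
  finally show ?thesis by simp
qed

end

section \<open>The majority rule and comparison of interactions between cells\<close>

lemma cell_coord_diff:
  assumes "0 < e" "x \<in> cell e i" "y \<in> cell e j"
  shows "\<bar>(x $ n - y $ n) - e * real_of_int (i $ n - j $ n)\<bar> < e"
proof -
  have "site e i $ n - e / 2 \<le> x $ n \<and> x $ n < site e i $ n + e / 2"
       "site e j $ n - e / 2 \<le> y $ n \<and> y $ n < site e j $ n + e / 2"
    using assms mem_cell_iff by blast+
  then show ?thesis
    by (simp add: site_def algebra_simps abs_less_iff)
qed

lemma l1norm_diff_le_of_cells:
  fixes i j :: "int ^ 'd"
  assumes "0 < e" "x \<in> cell e i" "y \<in> cell e j" "\<And>n. \<bar>i $ n - j $ n\<bar> \<le> m"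
  shows "l1norm (x - y) \<le> real CARD('d) * (e * (real_of_int m + 1))"
proof (rule l1norm_le_card)
  fix n
  have "\<bar>e * real_of_int (i $ n - j $ n)\<bar> \<le> e * real_of_int m"
    using assms(1) assms(4)[of n] by (simp add: abs_mult)
  then show "\<bar>(x - y) $ n\<bar> \<le> e * (real_of_int m + 1)"
    using cell_coord_diff[OF assms(1-3), of n] by (simp add: algebra_simps abs_less_iff abs_le_iff)
qed

lemma l1norm_diff_le_of_same_cell:
  fixes i :: "int ^ 'd"
  assumes "0 < e" "x \<in> cell e i" "y \<in> cell e i"
  shows "l1norm (x - y) \<le> real CARD('d) * e"
  using l1norm_diff_le_of_cells[OF assms, of 0] by simp

definition interior_site :: "real \<Rightarrow> real \<Rightarrow> int ^ 'd \<Rightarrow> bool" where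
  "interior_site R e i \<longleftrightarrow> cube (site e i) (e / 2) \<subseteq> cube 0 R"

text \<open>Well inside the cube a site follows the majority of its cell: this loses at most a constant
  factor in the interaction of any two cells. Elsewhere only the pointwise convergence matters,
  and there the inner approximation of the open set does the job.\<close>

definition lattice_approx :: "(real ^ 'd) set \<Rightarrow> real \<Rightarrow> real \<Rightarrow> int ^ 'd \<Rightarrow> int" where
  "lattice_approx E R e i = (if
     (if interior_site R e i then emeasure lborel (cell e i - E) \<le> emeasure lborel (cell e i \<inter> E)
      else cube (site e i) (e / 2) \<subseteq> E) then 1 else -1)"

lemma configuration_lattice_approx: "configuration (lattice_approx E R e)"
  by (simp add: configuration_def lattice_approx_def)

lemma interior_site_subset_discrete_cube:
  assumes "0 < e"
  shows "Collect (interior_site R e) \<subseteq> discrete_cube R e"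
proof
  fix i :: "int ^ 'd" assume "i \<in> Collect (interior_site R e)"
  moreover have "site e i \<in> cube (site e i) (e / 2)"
    using assms by (simp add: cube_def)
  ultimately have "site e i \<in> cube 0 R"
    by (auto simp: interior_site_def)
  then have R: "\<bar>e * real_of_int (i $ n)\<bar> \<le> R" for n
    by (simp add: cube_def site_def)
  have "\<bar>i $ n\<bar> \<le> \<lceil>R / e\<rceil>" for n
  proof -
    have "real_of_int \<bar>i $ n\<bar> \<le> R / e"
      using R[of n] assms by (simp add: field_simps abs_mult)
    then show ?thesis by linarith
  qed
  then show "i \<in> discrete_cube R e"
    unfolding discrete_cube_def by blast
qed

lemma half_cell_measure:
  fixes i :: "int ^ 'd"
  assumes e: "0 < e" and E: "E \<in> sets borel"
    and le: "emeasure lborel (cell e i - E) \<le> emeasure lborel (cell e i \<inter> E)"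
  shows "ennreal (e ^ CARD('d) / 2) \<le> emeasure lborel (cell e i \<inter> E)"
proof -
  have "emeasure lborel (cell e i \<inter> E) + emeasure lborel (cell e i - E) = emeasure lborel (cell e i)"
    using e E by (subst plus_emeasure) (auto simp: Int_Diff_Un)
  then have sum: "emeasure lborel (cell e i \<inter> E) + emeasure lborel (cell e i - E) = ennreal (e ^ CARD('d))"
    using emeasure_cell[OF e] by simp
  show ?thesis
  proof (rule ccontr)
    assume "\<not> ennreal (e ^ CARD('d) / 2) \<le> emeasure lborel (cell e i \<inter> E)"
    then have "emeasure lborel (cell e i \<inter> E) < ennreal (e ^ CARD('d) / 2)"
      "emeasure lborel (cell e i - E) < ennreal (e ^ CARD('d) / 2)"
      using le by auto
    then have "emeasure lborel (cell e i \<inter> E) + emeasure lborel (cell e i - E)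
        < ennreal (e ^ CARD('d) / 2) + ennreal (e ^ CARD('d) / 2)"
      by (rule add_strict_mono)
    also have "\<dots> = ennreal (e ^ CARD('d))"
      using e by (simp add: ennreal_plus[symmetric] del: ennreal_plus)
    finally show False using sum by simp
  qed
qed

text \<open>Only \<open>A\<close> is replaced by a lower bound on its volume; the volume of
  \<open>B\<close> is kept because in \<open>cell_mismatch_le\<close> it is the minority part of a
  cell and may be arbitrarily small.\<close>

lemma (in fractional_kernel) \<nu>_Times_ge:
  fixes A B :: "(real ^ 'd) set"
  assumes AB: "A \<in> sets borel" "B \<in> sets borel"
    and near: "\<And>x y. x \<in> A \<Longrightarrow> y \<in> B \<Longrightarrow> x \<noteq> y \<and> l1norm (x - y) \<le> t"
    and a: "ennreal a \<le> emeasure lborel A" and "0 \<le> a" "0 < t"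
  shows "ennreal (lam * t powr (- (real CARD('d) + s)) * a) * emeasure lborel B \<le> emeasure \<nu> (A \<times> B)"
proof -
  let ?c = "lam * t powr (- (real CARD('d) + s))"
  have "ennreal (?c * a) * emeasure lborel B = ennreal ?c * (ennreal a * emeasure lborel B)"
    using lam \<open>0 \<le> a\<close> by (subst ennreal_mult) (auto simp: mult.assoc)
  also have "\<dots> \<le> ennreal ?c * (emeasure lborel A * emeasure lborel B)"
    using a by (intro mult_left_mono mult_right_mono) auto
  also have "\<dots> = ennreal ?c * emeasure lborel (A \<times> B)"
    using AB by (simp add: emeasure_lborel_Times)
  also have "\<dots> \<le> emeasure \<nu> (A \<times> B)"
    using AB near k_ge_of_near[of _ _ t] by (intro \<nu>_ge borel_Times) blast+
  finally show ?thesis .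
qed

text \<open>Replacing two distinct cells by subsets of at least half their volume costs a constant
  factor, uniformly in \<open>e\<close>. For separated cells all mutual distances are comparable,
  hence so are all kernel values. For touching cells the kernel is unbounded, but the interaction of
  a cell with its entire complement is \<open>O(e powr (d - s))\<close>, the same order as the lower
  bound from distances of order \<open>e\<close>.\<close>

lemma (in fractional_kernel) \<nu>_cell_pair_le:
  "\<exists>C\<ge>0. \<forall>e i j A B. 0 < e \<longrightarrow> i \<noteq> j \<longrightarrow> A \<in> sets borel \<longrightarrow> B \<in> sets borel \<longrightarrow>
     A \<subseteq> cell e i \<longrightarrow> B \<subseteq> cell e j \<longrightarrow>
     ennreal (e ^ CARD('d) / 2) \<le> emeasure lborel A \<longrightarrow> ennreal (e ^ CARD('d) / 2) \<le> emeasure lborel B \<longrightarrow>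
     emeasure \<nu> (cell e i \<times> cell e j) \<le> ennreal C * emeasure \<nu> (A \<times> B)"
proof -
  obtain M where M: "0 \<le> M" "\<And>e i. 0 < e \<Longrightarrow> emeasure \<nu> (cell e i \<times> - cell e i) \<le> ennreal (M * e powr (real CARD('d) - s))"
    using \<nu>_cell_Compl_le by blast
  define b where "b = - (real CARD('d) + s)"
  define d where "d = real CARD('d)"
  have d: "0 < d" by (simp add: d_def)
  \<comment> \<open>The 4 undoes the two halvings of volume. For touching cells distances are at
    most \<open>2 * d * e\<close>; for separated ones at most \<open>3 * d\<close> times the minimal
    distance \<open>e * (m - 1)\<close>, because m + 1 \<le> 3 (m - 1) for m \<ge> 2.\<close>
  define C1 where "C1 = 4 * Lam / (lam * (3 * d) powr b)"
  define C2 where "C2 = 4 * M / (lam * (2 * d) powr b)"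
  have C: "0 \<le> C1" "0 \<le> C2"
    using lam M by (auto simp: C1_def C2_def)
  have "emeasure \<nu> (cell e i \<times> cell e j) \<le> ennreal (max C1 C2) * emeasure \<nu> (A \<times> B)"
    if e: "0 < e" and ij: "i \<noteq> j" and AB: "A \<in> sets borel" "B \<in> sets borel"
      and sub: "A \<subseteq> cell e i" "B \<subseteq> cell e j"
      and A: "ennreal (e ^ CARD('d) / 2) \<le> emeasure lborel A"
      and B: "ennreal (e ^ CARD('d) / 2) \<le> emeasure lborel B" for e i j A B
  proof -
    define V where "V = e ^ CARD('d)"
    have V: "0 < V" using e by (simp add: V_def)
    \<comment> \<open>Sup-norm distance of the two sites; the coordinate \<open>n0\<close> attaining
      it supplies the lower bound on distances between separated cells.\<close>
    define m where "m = Max (range (\<lambda>n. \<bar>i $ n - j $ n\<bar>))"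
    have mle: "\<bar>i $ n - j $ n\<bar> \<le> m" for n
      unfolding m_def by (intro Max_ge) auto
    have "m \<in> range (\<lambda>n. \<bar>i $ n - j $ n\<bar>)"
      unfolding m_def by (intro Max_in) auto
    then obtain n0 where n0: "m = \<bar>i $ n0 - j $ n0\<bar>" by auto
    obtain n1 where "i $ n1 \<noteq> j $ n1"
      using ij by (auto simp: vec_eq_iff)
    then have m1: "1 \<le> m"
      using mle[of n1] by linarith
    have lower: "ennreal (lam * t powr b * (V / 2) * (V / 2)) \<le> emeasure \<nu> (A \<times> B)"
      if t: "0 < t" and le: "d * (e * (real_of_int m + 1)) \<le> t" for t
    proof -
      have "ennreal (lam * t powr b * (V / 2) * (V / 2)) = ennreal (lam * t powr b * (V / 2)) * ennreal (V / 2)"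
        using lam V by (intro ennreal_mult) auto
      also have "\<dots> \<le> ennreal (lam * t powr b * (V / 2)) * emeasure lborel B"
        using B by (intro mult_left_mono) (auto simp: V_def)
      also have "\<dots> \<le> emeasure \<nu> (A \<times> B)"
        unfolding b_def
      proof (rule \<nu>_Times_ge[OF AB])
        fix x y assume xy: "x \<in> A" "y \<in> B"
        then have mem: "x \<in> cell e i" "y \<in> cell e j" using sub by auto
        then have "x \<noteq> y" using ij by (auto simp: cell_def)
        moreover have "l1norm (x - y) \<le> t"
          using l1norm_diff_le_of_cells[OF e mem mle] le unfolding d_def by linarith
        ultimately show "x \<noteq> y \<and> l1norm (x - y) \<le> t" by simp
      qed (use A V t in \<open>auto simp: V_def\<close>)
      finally show ?thesis .
    qed
    consider "m = 1" | "2 \<le> m" using m1 by linarith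
    then show ?thesis
    proof cases
      case 1
      have "emeasure \<nu> (cell e i \<times> cell e j) \<le> emeasure \<nu> (cell e i \<times> - cell e i)"
        using e cell_disjoint[OF ij, of e] by (intro emeasure_mono) (auto intro!: borel_Times)
      also have "\<dots> \<le> ennreal (M * e powr (real CARD('d) - s))"
        by (rule M(2)[OF e])
      \<comment> \<open>The exponents agree since d - s = -(d + s) + 2 d, the last term coming from
        the two cell volumes.\<close>
      also have "M * e powr (real CARD('d) - s) = C2 * (lam * (2 * d * e) powr b * (V / 2) * (V / 2))"
      proof -
        have "e powr (real CARD('d) - s) = e powr b * V * V"
          using e by (simp add: V_def b_def powr_realpow[symmetric] powr_add[symmetric])
        then show ?thesis
          using lam d e by (simp add: C2_def powr_mult)
      qed
      also have "ennreal \<dots> = ennreal C2 * ennreal (lam * (2 * d * e) powr b * (V / 2) * (V / 2))"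
        using C lam V by (intro ennreal_mult) auto
      also have "\<dots> \<le> ennreal (max C1 C2) * emeasure \<nu> (A \<times> B)"
        using lower[of "2 * d * e"] d e 1 by (intro mult_mono ennreal_leI) (auto simp: algebra_simps)
      finally show ?thesis .
    next
      case 2
      define t where "t = e * (real_of_int m - 1)"
      have t: "0 < t" using e 2 by (simp add: t_def)
      have far: "t \<le> l1norm (x - y)" if "x \<in> cell e i" "y \<in> cell e j" for x y
      proof -
        have "\<bar>e * real_of_int (i $ n0 - j $ n0)\<bar> = e * real_of_int m"
          using e unfolding n0 by (simp add: abs_mult)
        then have "t \<le> \<bar>x $ n0 - y $ n0\<bar>"
          using cell_coord_diff[OF e that, of n0] unfolding t_def by (simp add: algebra_simps)
        then show ?thesis
          using abs_component_le_l1norm[of "x - y" n0] by simp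
      qed
      have "emeasure \<nu> (cell e i \<times> cell e j) \<le> ennreal (Lam * t powr b) * emeasure lborel (cell e i \<times> cell e j)"
        unfolding b_def using e far k_le_of_far[OF t] by (intro \<nu>_le borel_Times) auto
      also have "\<dots> = ennreal (Lam * t powr b * (V * V))"
        using e lam by (simp add: emeasure_lborel_Times emeasure_cell V_def ennreal_mult[symmetric])
      also have "Lam * t powr b * (V * V) = C1 * (lam * (3 * d * t) powr b * (V / 2) * (V / 2))"
        using lam d t by (simp add: C1_def powr_mult)
      also have "ennreal \<dots> = ennreal C1 * ennreal (lam * (3 * d * t) powr b * (V / 2) * (V / 2))"
        using C lam V by (intro ennreal_mult) auto
      also have "\<dots> \<le> ennreal (max C1 C2) * emeasure \<nu> (A \<times> B)"
      proof -
        have "e * (real_of_int m + 1) \<le> 3 * t"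
          using e 2 unfolding t_def by (simp add: algebra_simps)
        then have "d * (e * (real_of_int m + 1)) \<le> 3 * d * t"
          using d by simp
        then have "ennreal (lam * (3 * d * t) powr b * (V / 2) * (V / 2)) \<le> emeasure \<nu> (A \<times> B)"
          using d t by (intro lower) auto
        then show ?thesis
          by (intro mult_mono ennreal_leI) auto
      qed
      finally show ?thesis .
    qed
  qed
  moreover have "0 \<le> max C1 C2" using C by simp
  ultimately show ?thesis by blast
qed

text \<open>A fractional isoperimetric inequality on one cell: distances are at most d
  \<open>e\<close>, so the kernel is at least of order \<open>e powr (- d - s)\<close>, and the
  larger of the two parts has volume at least \<open>e ^ d / 2\<close>. Their interaction therefore
  dominates the smaller volume times a multiple of \<open>e powr (- s)\<close>.\<close>

lemma (in fractional_kernel) cell_mismatch_le: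
  "\<exists>C\<ge>0. \<forall>e i E. 0 < e \<longrightarrow> E \<in> sets borel \<longrightarrow>
     min (emeasure lborel (cell e i \<inter> E)) (emeasure lborel (cell e i - E))
       \<le> ennreal (C * e powr s) * emeasure \<nu> ((cell e i \<inter> E) \<times> (cell e i - E))"
proof -
  define b where "b = - (real CARD('d) + s)"
  define d where "d = real CARD('d)"
  have d: "0 < d" by (simp add: d_def)
  define C where "C = 2 / (lam * d powr b)"
  have C: "0 \<le> C" using lam by (simp add: C_def)
  have *: "emeasure lborel (cell e i - E) \<le> ennreal (C * e powr s) * emeasure \<nu> ((cell e i \<inter> E) \<times> (cell e i - E))"
    if e: "0 < e" and E: "E \<in> sets borel" and le: "emeasure lborel (cell e i - E) \<le> emeasure lborel (cell e i \<inter> E)" for e i E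
  proof -
    define V where "V = e ^ CARD('d)"
    have V: "0 < V" using e by (simp add: V_def)
    let ?c = "lam * (d * e) powr b * (V / 2)"
    \<comment> \<open>\<open>C\<close> is chosen for this normalisation; the exponents s, -(d + s)
      and d of \<open>e\<close> add up to 0.\<close>
    have "C * e powr s * ?c = 1"
    proof -
      have "e powr s * e powr b * V = 1"
        using e by (simp add: V_def b_def powr_realpow[symmetric] powr_add[symmetric])
      moreover have "C * e powr s * ?c = e powr s * e powr b * V"
        using lam d e by (simp add: C_def powr_mult)
      ultimately show ?thesis by simp
    qed
    then have "emeasure lborel (cell e i - E) = ennreal (C * e powr s * ?c) * emeasure lborel (cell e i - E)"
      by simp
    also have "\<dots> = ennreal (C * e powr s) * (ennreal ?c * emeasure lborel (cell e i - E))"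
      using C lam V by (subst ennreal_mult) (auto simp: mult.assoc)
    also have "\<dots> \<le> ennreal (C * e powr s) * emeasure \<nu> ((cell e i \<inter> E) \<times> (cell e i - E))"
      unfolding b_def
    proof (intro mult_left_mono \<nu>_Times_ge)
      fix x y assume xy: "x \<in> cell e i \<inter> E" "y \<in> cell e i - E"
      then show "x \<noteq> y \<and> l1norm (x - y) \<le> d * e"
        unfolding d_def using l1norm_diff_le_of_same_cell[OF e] by auto
    qed (use e E V d half_cell_measure[OF e E le] in \<open>auto simp: V_def\<close>)
    finally show ?thesis .
  qed
  have "min (emeasure lborel (cell e i \<inter> E)) (emeasure lborel (cell e i - E))
       \<le> ennreal (C * e powr s) * emeasure \<nu> ((cell e i \<inter> E) \<times> (cell e i - E))"
    if e: "0 < e" and E: "E \<in> sets borel" for e i E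
  proof (cases "emeasure lborel (cell e i - E) \<le> emeasure lborel (cell e i \<inter> E)")
    case True
    then show ?thesis using *[OF e E True] by (simp add: min_def)
  next
    case False
    have eq: "cell e i - - E = cell e i \<inter> E" "cell e i \<inter> - E = cell e i - E" by auto
    have "emeasure lborel (cell e i \<inter> E) \<le> ennreal (C * e powr s) * emeasure \<nu> ((cell e i - E) \<times> (cell e i \<inter> E))"
      using *[of e "- E" i] e E False unfolding eq by auto
    also have "emeasure \<nu> ((cell e i - E) \<times> (cell e i \<inter> E)) = emeasure \<nu> ((cell e i \<inter> E) \<times> (cell e i - E))"
      using e E by (intro emeasure_\<nu>_Times_commute) auto
    finally show ?thesis
      by (rule order_trans[OF min.cobounded1])
  qed
  with C show ?thesis by blast
qed

section \<open>Discretisation estimates\<close>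

text \<open>The region where the singularity of the kernel matters. Both points are required in
  \<open>Q\<close>, because pairs leaving the cube have finite mass and are treated by dominated
  convergence.\<close>

definition near_crossing :: "(real ^ 'd) set \<Rightarrow> (real ^ 'd) set \<Rightarrow> real \<Rightarrow> ((real ^ 'd) \<times> (real ^ 'd)) set" where
  "near_crossing Q F \<delta> = {(x, y). x \<in> Q \<and> y \<in> Q \<and> (x \<in> F) \<noteq> (y \<in> F) \<and> l1norm (x - y) < \<delta>}"

lemma near_borel: "{(x, y). l1norm (x - y :: real ^ 'd) < \<delta>} \<in> sets borel"
proof -
  have "{(x, y). l1norm (x - y :: real ^ 'd) < \<delta>} = {p. l1norm (fst p - snd p) < \<delta>}"
    by auto
  also have "\<dots> \<in> sets borel"
    by (intro borel_open open_Collect_less continuous_intros)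
  finally show ?thesis .
qed

lemma near_crossing_eq: "near_crossing Q F \<delta> = crossing Q F \<inter> (Q \<times> Q) \<inter> {(x, y). l1norm (x - y) < \<delta>}"
  by (auto simp: near_crossing_def crossing_def)

lemma near_crossing_borel [measurable]:
  assumes "Q \<in> sets borel" "F \<in> sets borel"
  shows "near_crossing Q F \<delta> \<in> sets borel"
  unfolding near_crossing_eq using assms
  by (intro sets.Int crossing_borel borel_Times near_borel)

lemma near_crossing_mono: "\<delta> \<le> \<delta>' \<Longrightarrow> near_crossing Q F \<delta> \<subseteq> near_crossing Q F \<delta>'"
  by (auto simp: near_crossing_def)

abbreviation approx_region :: "(real ^ 'd) set \<Rightarrow> real \<Rightarrow> real \<Rightarrow> (real ^ 'd) set" where
  "approx_region E R e \<equiv> {x. lattice_approx E R e (cell_index e x) = 1}"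

abbreviation interior_cells :: "real \<Rightarrow> real \<Rightarrow> (real ^ 'd) set" where
  "interior_cells R e \<equiv> {x. interior_site R e (cell_index e x)}"

abbreviation lattice_cube :: "real \<Rightarrow> real \<Rightarrow> (real ^ 'd) set" where
  "lattice_cube R e \<equiv> {x. cell_index e x \<in> discrete_cube R e}"

lemma finite_interior_site: "0 < e \<Longrightarrow> finite (Collect (interior_site R e))"
  using interior_site_subset_discrete_cube finite_discrete_cube by (rule finite_subset)

lemma interior_cell_subset: "0 < e \<Longrightarrow> interior_site R e i \<Longrightarrow> cell e i \<subseteq> cube 0 R"
  unfolding interior_site_def using cell_subset_cube by blast

lemma interior_cells_subset: "0 < e \<Longrightarrow> interior_cells R e \<subseteq> cube 0 R"
  using interior_cell_subset by (force simp: cell_def)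

lemma cube_subset_lattice_cube:
  assumes "0 < e"
  shows "cube 0 R \<subseteq> lattice_cube R e"
proof
  fix x :: "real ^ 'd" assume "x \<in> cube 0 R"
  then have x: "\<bar>x $ n\<bar> \<le> R" for n by (simp add: cube_def)
  have "\<bar>\<lfloor>x $ n / e + 1/2\<rfloor>\<bar> \<le> \<lceil>R / e\<rceil>" for n
  proof -
    have "\<bar>x $ n / e\<bar> \<le> R / e"
      using x[of n] assms by (simp add: divide_right_mono)
    then show ?thesis by linarith
  qed
  then show "x \<in> lattice_cube R e"
    by (simp add: discrete_cube_def cell_index_def)
qed

text \<open>The ceiling overshoots \<open>R\<close> by at most one mesh size and the cell around an
  outermost site adds half of one.\<close>

lemma lattice_cube_bound:
  assumes "0 < e" "x \<in> lattice_cube R e"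
  shows "\<bar>x $ n\<bar> \<le> R + 3 / 2 * e"
proof -
  let ?i = "cell_index e x"
  have "x \<in> cube (site e ?i) (e / 2)"
    using cell_subset_cube[OF assms(1), of ?i] by (auto simp: cell_def)
  then have 1: "\<bar>x $ n - e * real_of_int (?i $ n)\<bar> \<le> e / 2"
    unfolding cube_def site_def by simp
  have "\<bar>?i $ n\<bar> \<le> \<lceil>R / e\<rceil>"
    using assms(2) by (simp add: discrete_cube_def)
  then have "\<bar>real_of_int (?i $ n)\<bar> \<le> R / e + 1"
    by linarith
  then have "e * \<bar>real_of_int (?i $ n)\<bar> \<le> e * (R / e + 1)"
    using assms(1) by (intro mult_left_mono) auto
  then have "\<bar>e * real_of_int (?i $ n)\<bar> \<le> R + e"
    using assms(1) by (simp add: abs_mult algebra_simps)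
  with 1 show ?thesis by linarith
qed

text \<open>A non-interior cell contains a point outside \<open>cube 0 R\<close>, so its points have
  a coordinate of modulus above \<open>R - e\<close>, which is \<open>(R + 2 * e) - 3 * e\<close>.
  The outer radius \<open>R + 2 * e\<close> leaves room for the overshoot \<open>3 / 2 * e\<close>,
  and the zero vector is spelled out to match \<open>emeasure_boundary_layer_le\<close>.\<close>

lemma boundary_cells_subset_layer:
  assumes "0 < e"
  shows "lattice_cube R e - interior_cells R e
    \<subseteq> {x \<in> cube 0 (R + 2 * e). \<exists>n. (0 :: real ^ 'd) $ n + (R + 2 * e) - 3 * e \<le> x $ n
        \<or> x $ n \<le> (0 :: real ^ 'd) $ n - (R + 2 * e) + 3 * e}"
proof
  fix x :: "real ^ 'd" assume x: "x \<in> lattice_cube R e - interior_cells R e"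
  let ?i = "cell_index e x"
  have "\<bar>x $ n\<bar> \<le> R + 2 * e" for n
    using lattice_cube_bound[OF assms, of x R n] x assms by auto
  then have 1: "x \<in> cube 0 (R + 2 * e)"
    by (simp add: cube_def)
  obtain z where z: "z \<in> cube (site e ?i) (e / 2)" "z \<notin> cube 0 R"
    using x by (auto simp: interior_site_def)
  then obtain n where n: "\<bar>z $ n\<bar> > R"
    by (auto simp: cube_def not_le)
  have "x \<in> cube (site e ?i) (e / 2)"
    using cell_subset_cube[OF assms, of ?i] by (auto simp: cell_def)
  then have "\<bar>x $ n - site e ?i $ n\<bar> \<le> e / 2" "\<bar>z $ n - site e ?i $ n\<bar> \<le> e / 2"
    using z(1) unfolding cube_def by blast+
  then have "(0 :: real ^ 'd) $ n + (R + 2 * e) - 3 * e \<le> x $ n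
        \<or> x $ n \<le> (0 :: real ^ 'd) $ n - (R + 2 * e) + 3 * e"
    using n by (simp only: zero_index) linarith
  with 1 show "x \<in> {x \<in> cube 0 (R + 2 * e). \<exists>n. (0 :: real ^ 'd) $ n + (R + 2 * e) - 3 * e \<le> x $ n
        \<or> x $ n \<le> (0 :: real ^ 'd) $ n - (R + 2 * e) + 3 * e}"
    by blast
qed

text \<open>A boundary layer of cells has about \<open>e powr (1 - d)\<close> members, and each of them interacts with
  the other cells at most with strength \<open>e powr (d - s)\<close>; this is where \<open>s < 1\<close> enters.\<close>

lemma (in fractional_kernel) \<nu>_boundary_cells_le:
  assumes R: "0 < R"
  shows "\<exists>C\<ge>0. \<forall>e. 0 < e \<longrightarrow> e < 1 \<longrightarrow>
    emeasure \<nu> {(x, y). x \<in> lattice_cube R e - interior_cells R e \<and> cell_index e x \<noteq> cell_index e y}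
      \<le> ennreal (C * e powr (1 - s))"
proof -
  obtain M where M: "0 \<le> M" "\<And>e i. 0 < e \<Longrightarrow> emeasure \<nu> (cell e i \<times> - cell e i) \<le> ennreal (M * e powr (real CARD('d) - s))"
    using \<nu>_cell_Compl_le by blast
  define D where "D = 2 * real CARD('d) * 3 * (2 * (R + 2)) ^ (CARD('d) - 1)"
  have "emeasure \<nu> {(x, y). x \<in> lattice_cube R e - interior_cells R e \<and> cell_index e x \<noteq> cell_index e y}
      \<le> ennreal (M * D * e powr (1 - s))" if e: "0 < e" "e < 1" for e
  proof -
    let ?I = "discrete_cube R e - Collect (interior_site R e) :: (int ^ 'd) set"
    have fin: "finite ?I" using finite_discrete_cube by auto
    have "{(x, y). x \<in> lattice_cube R e - interior_cells R e \<and> cell_index e x \<noteq> cell_index e y}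
        = (\<Union>i\<in>?I. cell e i \<times> - cell e i)"
      by (auto simp: cell_def)
    also have "emeasure \<nu> \<dots> \<le> (\<Sum>i\<in>?I. emeasure \<nu> (cell e i \<times> - cell e i))"
      using fin e by (intro emeasure_subadditive_finite) (auto intro!: borel_Times)
    also have "\<dots> \<le> (\<Sum>i\<in>?I. ennreal (M * e powr (real CARD('d) - s)))"
      using e by (intro sum_mono M) auto
    \<comment> \<open>One factor \<open>e ^ d\<close> is read as the volume of the cell, which turns
      counting boundary cells into measuring the layer they fill.\<close>
    also have "\<dots> = (\<Sum>i\<in>?I. ennreal (M * e powr (- s)) * emeasure lborel (cell e i))"
    proof (rule sum.cong)
      fix i :: "int ^ 'd"
      have "M * e powr (real CARD('d) - s) = M * e powr (- s) * e ^ CARD('d)"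
        using e by (simp add: powr_realpow[symmetric] powr_add[symmetric])
      then show "ennreal (M * e powr (real CARD('d) - s)) = ennreal (M * e powr (- s)) * emeasure lborel (cell e i)"
        using e M(1) by (simp only: emeasure_cell) (intro ennreal_mult, auto)
    qed simp
    also have "\<dots> = ennreal (M * e powr (- s)) * (\<Sum>i\<in>?I. emeasure lborel (cell e i))"
      by (simp add: sum_distrib_left)
    also have "(\<Sum>i\<in>?I. emeasure lborel (cell e i)) = emeasure lborel (\<Union>i\<in>?I. cell e i)"
      using fin e by (intro sum_emeasure) (auto simp: disjoint_family_on_def cell_disjoint)
    also have "(\<Union>i\<in>?I. cell e i) = lattice_cube R e - interior_cells R e"
      by (auto simp: cell_def)
    also have "emeasure lborel \<dots> \<le> ennreal (2 * real CARD('d) * (3 * e) * (2 * (R + 2 * e)) ^ (CARD('d) - 1))"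
      using e R boundary_layer_borel[of 0 "R + 2 * e" "3 * e"]
      by (intro order_trans[OF emeasure_mono[OF boundary_cells_subset_layer] emeasure_boundary_layer_le]) auto
    also have "\<dots> \<le> ennreal (D * e)"
    proof (rule ennreal_leI)
      have "(2 * (R + 2 * e)) ^ (CARD('d) - 1) \<le> (2 * (R + 2)) ^ (CARD('d) - 1)"
        using e R by (intro power_mono) auto
      then have "(2 * real CARD('d) * (3 * e)) * (2 * (R + 2 * e)) ^ (CARD('d) - 1)
          \<le> (2 * real CARD('d) * (3 * e)) * (2 * (R + 2)) ^ (CARD('d) - 1)"
        using e by (intro mult_left_mono) auto
      also have "\<dots> = D * e" by (simp add: D_def)
      finally show "2 * real CARD('d) * (3 * e) * (2 * (R + 2 * e)) ^ (CARD('d) - 1) \<le> D * e" .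
    qed
    finally have "emeasure \<nu> {(x, y). x \<in> lattice_cube R e - interior_cells R e \<and> cell_index e x \<noteq> cell_index e y}
        \<le> ennreal (M * e powr (- s)) * ennreal (D * e)"
      by (simp add: mult_left_mono)
    also have "\<dots> = ennreal (M * D * e powr (1 - s))"
      using e M R by (subst ennreal_mult[symmetric]) (auto simp: D_def powr_diff powr_minus field_simps)
    finally show ?thesis .
  qed
  moreover have "0 \<le> M * D" using M R by (simp add: D_def)
  ultimately show ?thesis by blast
qed

text \<open>Interior cells with opposite spins have their majority parts on opposite sides of
  \<open>E\<close>. \<open>\<nu>_cell_pair_le\<close> bounds the interaction of such cells by that
  of these parts, and the products of the parts are disjoint sets of pairs separated by
  \<open>E\<close>. Moving both points within their cells lengthens the distance by at most
  \<open>2 * d * e\<close>, hence the wider band on the right.\<close>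

lemma (in fractional_kernel) \<nu>_near_crossing_approx_le:
  "\<exists>C\<ge>0. \<forall>E R e \<delta>. E \<in> sets borel \<longrightarrow> 0 < e \<longrightarrow>
     emeasure \<nu> (near_crossing (interior_cells R e) (approx_region E R e) \<delta>)
       \<le> ennreal C * emeasure \<nu> (near_crossing (cube 0 R) E (\<delta> + 2 * real CARD('d) * e))"
proof -
  obtain C where C: "0 \<le> C" "\<And>e i j A B. 0 < e \<Longrightarrow> i \<noteq> j \<Longrightarrow> A \<in> sets borel \<Longrightarrow> B \<in> sets borel \<Longrightarrow>
     A \<subseteq> cell e i \<Longrightarrow> B \<subseteq> cell e j \<Longrightarrow>
     ennreal (e ^ CARD('d) / 2) \<le> emeasure lborel A \<Longrightarrow> ennreal (e ^ CARD('d) / 2) \<le> emeasure lborel B \<Longrightarrow>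
     emeasure \<nu> (cell e i \<times> cell e j) \<le> ennreal C * emeasure \<nu> (A \<times> B)"
    using \<nu>_cell_pair_le by metis
  have "emeasure \<nu> (near_crossing (interior_cells R e) (approx_region E R e) \<delta>)
       \<le> ennreal C * emeasure \<nu> (near_crossing (cube 0 R) E (\<delta> + 2 * real CARD('d) * e))"
    if E [measurable]: "E \<in> sets borel" and e: "0 < e" for E R e \<delta>
  proof -
    let ?u = "lattice_approx E R e"
    define A where "A i = (if ?u i = 1 then cell e i \<inter> E else cell e i - E)" for i
    define P where "P = {(i, j). interior_site R e i \<and> interior_site R e j \<and> (?u i = 1) \<noteq> (?u j = 1)
        \<and> (\<exists>x\<in>cell e i. \<exists>y\<in>cell e j. l1norm (x - y) < \<delta>)}"
    have A [measurable]: "A i \<in> sets borel" "A i \<subseteq> cell e i" for i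
      using e by (auto simp: A_def)
    have half: "ennreal (e ^ CARD('d) / 2) \<le> emeasure lborel (A i)" if "interior_site R e i" for i
    proof (cases "?u i = 1")
      case True
      then show ?thesis
        using half_cell_measure[OF e E, of i] \<open>interior_site R e i\<close>
        by (auto simp: A_def lattice_approx_def split: if_splits)
    next
      case False
      have eq: "cell e i - - E = cell e i \<inter> E" "cell e i \<inter> - E = cell e i - E" by auto
      show ?thesis
        using half_cell_measure[OF e, of "- E" i] False \<open>interior_site R e i\<close> unfolding eq
        by (auto simp: A_def lattice_approx_def split: if_splits)
    qed
    have finP: "finite P"
      by (rule finite_subset[of _ "Collect (interior_site R e) \<times> Collect (interior_site R e)"])
        (use finite_interior_site[OF e] in \<open>auto simp: P_def\<close>)
    have "near_crossing (interior_cells R e) (approx_region E R e) \<delta> \<subseteq> (\<Union>p\<in>P. cell e (fst p) \<times> cell e (snd p))"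
    proof clarify
      fix x y assume "(x, y) \<in> near_crossing (interior_cells R e) (approx_region E R e) \<delta>"
      then have "(cell_index e x, cell_index e y) \<in> P"
        by (auto simp: near_crossing_def P_def cell_def)
      then show "(x, y) \<in> (\<Union>p\<in>P. cell e (fst p) \<times> cell e (snd p))"
        by (rule UN_I) (simp add: cell_def)
    qed
    then have "emeasure \<nu> (near_crossing (interior_cells R e) (approx_region E R e) \<delta>)
        \<le> emeasure \<nu> (\<Union>p\<in>P. cell e (fst p) \<times> cell e (snd p))"
      using e finP by (intro emeasure_mono) (auto intro!: sets.finite_UN borel_Times)
    also have "\<dots> \<le> (\<Sum>p\<in>P. emeasure \<nu> (cell e (fst p) \<times> cell e (snd p)))"
      using e finP by (intro emeasure_subadditive_finite) (auto intro!: borel_Times)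
    also have "\<dots> \<le> (\<Sum>p\<in>P. ennreal C * emeasure \<nu> (A (fst p) \<times> A (snd p)))"
    proof (intro sum_mono C)
      fix p assume p: "p \<in> P"
      then show "fst p \<noteq> snd p" by (auto simp: P_def)
      show "ennreal (e ^ CARD('d) / 2) \<le> emeasure lborel (A (fst p))"
           "ennreal (e ^ CARD('d) / 2) \<le> emeasure lborel (A (snd p))"
        using p by (auto intro!: half simp: P_def)
    qed (use A e in auto)
    also have "\<dots> = ennreal C * (\<Sum>p\<in>P. emeasure \<nu> (A (fst p) \<times> A (snd p)))"
      by (simp add: sum_distrib_left)
    also have "(\<Sum>p\<in>P. emeasure \<nu> (A (fst p) \<times> A (snd p))) = emeasure \<nu> (\<Union>p\<in>P. A (fst p) \<times> A (snd p))"
    proof (rule sum_emeasure)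
      have "cell_index e x = i" if "x \<in> A i" for x i
        using that A(2)[of i] by (auto simp: cell_def)
      then have "p = q" if "(x, y) \<in> A (fst p) \<times> A (snd p)" "(x, y) \<in> A (fst q) \<times> A (snd q)" for p q x y
        using that by (metis mem_Times_iff prod_eq_iff fst_conv snd_conv)
      then show "disjoint_family_on (\<lambda>p. A (fst p) \<times> A (snd p)) P"
        unfolding disjoint_family_on_def by (metis disjoint_iff surj_pair)
    qed (use finP A in \<open>auto intro!: borel_Times\<close>)
    also have "\<dots> \<le> emeasure \<nu> (near_crossing (cube 0 R) E (\<delta> + 2 * real CARD('d) * e))"
    proof (rule emeasure_mono)
      show "(\<Union>p\<in>P. A (fst p) \<times> A (snd p)) \<subseteq> near_crossing (cube 0 R) E (\<delta> + 2 * real CARD('d) * e)"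
      proof clarify
        fix i j x y assume p: "(i, j) \<in> P" and xy: "x \<in> A (fst (i, j))" "y \<in> A (snd (i, j))"
        then have cells: "x \<in> cell e i" "y \<in> cell e j" using A(2) by auto
        obtain x' y' where x': "x' \<in> cell e i" "y' \<in> cell e j" "l1norm (x' - y') < \<delta>"
          using p by (auto simp: P_def)
        have "l1norm (x - y) \<le> l1norm (x - x') + (l1norm (x' - y') + l1norm (y' - y))"
          using l1norm_triangle[of x y x'] l1norm_triangle[of x' y y'] by linarith
        then have "l1norm (x - y) < \<delta> + 2 * real CARD('d) * e"
          using l1norm_diff_le_of_same_cell[OF e cells(1) x'(1)] l1norm_diff_le_of_same_cell[OF e x'(2) cells(2)] x'(3)
          by linarith
        moreover have "x \<in> cube 0 R" "y \<in> cube 0 R"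
          using p cells interior_cell_subset[OF e] by (auto simp: P_def)
        moreover have "(x \<in> E) \<noteq> (y \<in> E)"
          using p xy by (auto simp: P_def A_def split: if_splits)
        ultimately show "(x, y) \<in> near_crossing (cube 0 R) E (\<delta> + 2 * real CARD('d) * e)"
          by (simp add: near_crossing_def)
      qed
    qed simp
    finally show ?thesis
      by (simp add: mult_left_mono)
  qed
  then show ?thesis
    using C(1) by (intro exI[of _ C] conjI allI impI)
qed

text \<open>By the majority rule the error in an interior cell is exactly its minority part, to
  which \<open>cell_mismatch_le\<close> applies; the interactions within different cells are
  disjoint portions of the crossing of \<open>E\<close>.\<close>

lemma (in fractional_kernel) approx_mismatch_le:
  "\<exists>C\<ge>0. \<forall>E R e. E \<in> sets borel \<longrightarrow> 0 < e \<longrightarrow>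
     emeasure lborel {x \<in> interior_cells R e. (x \<in> approx_region E R e) \<noteq> (x \<in> E)}
       \<le> ennreal (C * e powr s) * emeasure \<nu> (crossing (cube 0 R) E)"
proof -
  obtain C where C: "0 \<le> C" "\<And>e i E. 0 < e \<Longrightarrow> E \<in> sets borel \<Longrightarrow>
     min (emeasure lborel (cell e i \<inter> E)) (emeasure lborel (cell e i - E))
       \<le> ennreal (C * e powr s) * emeasure \<nu> ((cell e i \<inter> E) \<times> (cell e i - E))"
    using cell_mismatch_le by metis
  have "emeasure lborel {x \<in> interior_cells R e. (x \<in> approx_region E R e) \<noteq> (x \<in> E)}
       \<le> ennreal (C * e powr s) * emeasure \<nu> (crossing (cube 0 R) E)"
    if E [measurable]: "E \<in> sets borel" and e: "0 < e" for E R e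
  proof -
    let ?u = "lattice_approx E R e" and ?I = "Collect (interior_site R e) :: (int ^ 'd) set"
    have fin: "finite ?I" by (rule finite_interior_site[OF e])
    define B where "B i = (if ?u i = 1 then cell e i - E else cell e i \<inter> E)" for i
    have B: "B i \<in> sets borel" for i
      using e by (auto simp: B_def)
    have "{x \<in> interior_cells R e. (x \<in> approx_region E R e) \<noteq> (x \<in> E)} \<subseteq> (\<Union>i\<in>?I. B i)"
      by (auto simp: B_def cell_def)
    then have "emeasure lborel {x \<in> interior_cells R e. (x \<in> approx_region E R e) \<noteq> (x \<in> E)} \<le> emeasure lborel (\<Union>i\<in>?I. B i)"
      using B fin by (intro emeasure_mono) auto
    also have "\<dots> \<le> (\<Sum>i\<in>?I. emeasure lborel (B i))"
      using B fin by (intro emeasure_subadditive_finite) auto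
    also have "\<dots> \<le> (\<Sum>i\<in>?I. ennreal (C * e powr s) * emeasure \<nu> ((cell e i \<inter> E) \<times> (cell e i - E)))"
    proof (rule sum_mono)
      fix i assume "i \<in> ?I"
      then have "emeasure lborel (B i) = min (emeasure lborel (cell e i \<inter> E)) (emeasure lborel (cell e i - E))"
        by (auto simp: B_def lattice_approx_def min_def)
      also have "\<dots> \<le> ennreal (C * e powr s) * emeasure \<nu> ((cell e i \<inter> E) \<times> (cell e i - E))"
        by (rule C(2)[OF e E])
      finally show "emeasure lborel (B i) \<le> \<dots>" .
    qed
    also have "\<dots> = ennreal (C * e powr s) * (\<Sum>i\<in>?I. emeasure \<nu> ((cell e i \<inter> E) \<times> (cell e i - E)))"
      by (simp add: sum_distrib_left)
    also have "(\<Sum>i\<in>?I. emeasure \<nu> ((cell e i \<inter> E) \<times> (cell e i - E)))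
        = emeasure \<nu> (\<Union>i\<in>?I. (cell e i \<inter> E) \<times> (cell e i - E))"
    proof (rule sum_emeasure)
      show "disjoint_family_on (\<lambda>i. (cell e i \<inter> E) \<times> (cell e i - E)) ?I"
        unfolding disjoint_family_on_def using cell_disjoint by fast
    qed (use fin e in \<open>auto intro!: borel_Times\<close>)
    also have "\<dots> \<le> emeasure \<nu> (crossing (cube 0 R) E)"
    proof (rule emeasure_mono)
      show "(\<Union>i\<in>?I. (cell e i \<inter> E) \<times> (cell e i - E)) \<subseteq> crossing (cube 0 R) E"
        using interior_cell_subset[OF e] by (fastforce simp: crossing_def)
    qed simp
    finally show ?thesis
      by (simp add: mult_left_mono)
  qed
  then show ?thesis
    using C(1) by (intro exI[of _ C] conjI allI impI)
qed

context fractional_kernel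
begin

lemma \<nu>_cube_boundary_finite:
  assumes "0 < R"
  shows "emeasure \<nu> (cube 0 R \<times> - cube 0 R \<union> (- cube 0 R) \<times> cube 0 R) < \<infinity>"
proof -
  obtain M where "emeasure \<nu> (cube 0 R \<times> - cube 0 R) \<le> ennreal M"
    using \<nu>_cube_Compl_le assms by blast
  then have 1: "emeasure \<nu> (cube 0 R \<times> - cube 0 R) < \<infinity>"
    using order_le_less_trans by fastforce
  moreover have "emeasure \<nu> ((- cube 0 R) \<times> cube 0 R) = emeasure \<nu> (cube 0 R \<times> - cube 0 R)"
    by (intro emeasure_\<nu>_Times_commute) auto
  moreover have "emeasure \<nu> (cube 0 R \<times> - cube 0 R \<union> (- cube 0 R) \<times> cube 0 R)
      \<le> emeasure \<nu> (cube 0 R \<times> - cube 0 R) + emeasure \<nu> ((- cube 0 R) \<times> cube 0 R)"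
    by (intro emeasure_subadditive) (auto intro!: borel_Times)
  ultimately show ?thesis
    by (simp add: order_le_less_trans)
qed

text \<open>At distance at least \<delta> the kernel is bounded, and the cube has finite
  volume.\<close>

lemma \<nu>_far_finite:
  assumes "0 \<le> R" "0 < \<delta>"
  shows "emeasure \<nu> (cube 0 R \<times> cube 0 R - {(x, y). l1norm (x - y) < \<delta>}) < \<infinity>"
proof -
  let ?Z = "cube 0 R \<times> cube 0 R - {(x, y :: real ^ 'd). l1norm (x - y) < \<delta>}"
  have Z: "?Z \<in> sets borel"
    by (intro sets.Diff borel_Times near_borel) auto
  have "emeasure \<nu> ?Z \<le> ennreal (Lam * \<delta> powr (- (real CARD('d) + s))) * emeasure lborel ?Z"
    using k_le_of_far[OF assms(2)] by (intro \<nu>_le Z) auto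
  also have "\<dots> \<le> ennreal (Lam * \<delta> powr (- (real CARD('d) + s))) * emeasure lborel (cube 0 R \<times> cube 0 R :: ((real ^ 'd) \<times> (real ^ 'd)) set)"
    by (intro mult_left_mono emeasure_mono) (auto intro!: borel_Times)
  also have "\<dots> < \<infinity>"
    using assms by (simp add: emeasure_lborel_Times emeasure_cube ennreal_mult_less_top)
  finally show ?thesis .
qed

text \<open>No diagonal pair is separated by \<open>E\<close>, so these bands shrink to the empty
  set inside a crossing of finite measure.\<close>

lemma near_crossing_small:
  assumes E: "E \<in> sets borel" and fin: "emeasure \<nu> (crossing (cube 0 R) E) < \<infinity>" and "0 < \<eta>"
  obtains \<delta> where "0 < \<delta>" "emeasure \<nu> (near_crossing (cube 0 R) E \<delta>) < \<eta>"
proof -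
  have "(\<lambda>n. emeasure \<nu> (near_crossing (cube 0 R) E (1 / real (Suc n)))) \<longlonglongrightarrow> 0"
  proof (rule emeasure_tendsto_0_if_eventually_not_mem[of "crossing (cube 0 R) E"])
    show "AE p in \<nu>. eventually (\<lambda>n. p \<notin> near_crossing (cube 0 R) E (1 / real (Suc n))) sequentially"
    proof (rule AE_I2)
      fix p :: "(real ^ 'd) \<times> (real ^ 'd)"
      show "eventually (\<lambda>n. p \<notin> near_crossing (cube 0 R) E (1 / real (Suc n))) sequentially"
      proof (cases "fst p = snd p")
        case True
        then show ?thesis by (cases p) (simp add: near_crossing_def)
      next
        case False
        then have "0 < l1norm (fst p - snd p)"
          using l1norm_nonneg[of "fst p - snd p"] l1norm_eq_0[of "fst p - snd p"] by auto
        then have "eventually (\<lambda>n. 1 / real (Suc n) < l1norm (fst p - snd p)) sequentially"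
          using order_tendstoD(2)[OF LIMSEQ_inverse_real_of_nat] by (simp add: inverse_eq_divide)
        then show ?thesis
          by eventually_elim (cases p, simp add: near_crossing_def)
      qed
    qed
    show "near_crossing (cube 0 R) E (1 / real (Suc n)) \<subseteq> crossing (cube 0 R) E" for n
      by (auto simp: near_crossing_eq)
  qed (use E fin in auto)
  from order_tendstoD(2)[OF this \<open>0 < \<eta>\<close>]
  obtain n where "emeasure \<nu> (near_crossing (cube 0 R) E (1 / real (Suc n))) < \<eta>"
    by (auto simp: eventually_sequentially)
  then show ?thesis
    by (intro that[of "1 / real (Suc n)"]) auto
qed

end

section \<open>The lattice approximations along a rapidly decreasing mesh\<close>

text \<open>The rate \<open>es\<close> is arranged by extraction; it makes the volumes misjudged by
  the majority rule summable.\<close>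

locale lattice_sequence = fractional_kernel k s lam Lam
  for k :: "(real ^ 'd) \<times> (real ^ 'd) \<Rightarrow> ennreal" and s lam Lam :: real +
  fixes E :: "(real ^ 'd) set" and R :: real and e :: "nat \<Rightarrow> real"
  assumes openE: "open E" and R: "0 < R"
    and fin: "emeasure \<nu> (crossing (cube 0 R) E) < \<infinity>"
    and e: "0 < e n" "e n < 1" and e0: "e \<longlonglongrightarrow> 0" and es: "e n powr s \<le> (1/2) ^ n"
begin

lemma E_borel [measurable]: "E \<in> sets borel"
  using openE by (rule borel_open)

lemma approx_region_borel [measurable]: "approx_region E R (e n) \<in> sets borel"
  using e by (intro Collect_cell_index_borel) auto

lemma lattice_cube_borel [measurable]: "lattice_cube R (e n) \<in> sets borel"
  using e by (intro Collect_cell_index_borel) auto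

lemma interior_cells_borel [measurable]: "interior_cells R (e n) \<in> sets borel"
  using e by (intro Collect_cell_index_borel) auto

lemma eventually_mult_less: "0 < r \<Longrightarrow> eventually (\<lambda>n. c * e n < r) sequentially"
  using order_tendstoD(2)[OF tendsto_mult_right_zero[OF e0, of c], of r] .

lemma eventually_cell_subset:
  assumes "x \<in> E"
  shows "eventually (\<lambda>n. cube (site (e n) (cell_index (e n) x)) (e n / 2) \<subseteq> E) sequentially"
proof -
  obtain r where r: "0 < r" "ball x r \<subseteq> E"
    using openE assms by (auto simp: open_contains_ball)
  from eventually_mult_less[OF r(1), of "real CARD('d)"] show ?thesis
  proof eventually_elim
    case (elim n)
    let ?c = "site (e n) (cell_index (e n) x)"
    show ?case
    proof
      fix y assume "y \<in> cube ?c (e n / 2)"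
      then have y: "\<bar>y $ m - ?c $ m\<bar> \<le> e n / 2" for m
        unfolding cube_def by blast
      have "x \<in> cube ?c (e n / 2)"
        using cell_subset_cube[OF e(1)[of n], of "cell_index (e n) x"] by (auto simp: cell_def)
      then have x: "\<bar>x $ m - ?c $ m\<bar> \<le> e n / 2" for m
        unfolding cube_def by blast
      have "\<bar>(x - y) $ m\<bar> \<le> e n" for m
        using x[of m] y[of m] by (simp only: vector_minus_component)
      then have "l1norm (x - y) \<le> real CARD('d) * e n"
        by (rule l1norm_le_card)
      moreover have "dist x y \<le> l1norm (x - y)"
        unfolding dist_norm l1norm_def by (rule norm_le_l1_cart)
      ultimately have "y \<in> ball x r"
        using elim by simp
      then show "y \<in> E" using r by blast
    qed
  qed
qed

text \<open>On interior cells the misjudged volumes are bounded by a geometric sequence, so by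
  Borel-Cantelli almost every point is misjudged only finitely often. On the other cells convergence
  holds at every point, by openness of \<open>E\<close>.\<close>

lemma approx_converges:
  "AE x in lborel. eventually (\<lambda>n. x \<in> approx_region E R (e n) \<longleftrightarrow> x \<in> E) sequentially"
proof -
  let ?T = "\<lambda>n. {x \<in> interior_cells R (e n). (x \<in> approx_region E R (e n)) \<noteq> (x \<in> E)}"
  let ?P = "emeasure \<nu> (crossing (cube 0 R) E)"
  obtain C where C: "0 \<le> C" "\<And>n. emeasure lborel (?T n) \<le> ennreal (C * e n powr s) * ?P"
  proof -
    from approx_mismatch_le obtain C where "0 \<le> C" and C: "\<forall>E R e. E \<in> sets borel \<longrightarrow> 0 < e \<longrightarrow>
      emeasure lborel {x \<in> interior_cells R e. (x \<in> approx_region E R e) \<noteq> (x \<in> E)}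
        \<le> ennreal (C * e powr s) * emeasure \<nu> (crossing (cube 0 R) E)" by (elim exE conjE)
    show ?thesis
      by (rule that[OF \<open>0 \<le> C\<close> C[rule_format, OF E_borel e(1)]])
  qed
  have P: "?P = ennreal (enn2real ?P)"
    using fin by simp
  have T: "emeasure lborel (?T n) \<le> ennreal (C * enn2real ?P * (1/2) ^ n)" for n
  proof -
    have "emeasure lborel (?T n) \<le> ennreal (C * e n powr s) * ennreal (enn2real ?P)"
      using C(2)[of n] P by simp
    also have "\<dots> = ennreal (C * e n powr s * enn2real ?P)"
      using C(1) by (intro ennreal_mult[symmetric]) auto
    also have "\<dots> \<le> ennreal (C * enn2real ?P * (1/2) ^ n)"
    proof (rule ennreal_leI)
      have "(C * enn2real ?P) * e n powr s \<le> (C * enn2real ?P) * (1/2) ^ n"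
        using C(1) es[of n] by (intro mult_left_mono) auto
      then show "C * e n powr s * enn2real ?P \<le> C * enn2real ?P * (1/2) ^ n"
        by (simp add: mult_ac)
    qed
    finally show ?thesis .
  qed
  have Tm: "?T n \<in> sets lborel" for n
  proof -
    have "?T n = interior_cells R (e n) \<inter> ((approx_region E R (e n) - E) \<union> (E - approx_region E R (e n)))"
      by auto
    also have "\<dots> \<in> sets lborel"
      using approx_region_borel[of n] interior_cells_borel[of n] by (intro sets.Int sets.Un sets.Diff) auto
    finally show ?thesis .
  qed
  have "AE x in lborel. eventually (\<lambda>n. x \<in> space lborel - ?T n) sequentially"
  proof (rule borel_cantelli_AE1[OF Tm])
    show "emeasure lborel (?T n) < \<infinity>" for n
      using T[of n] by (rule order_le_less_trans) simp
    show "summable (\<lambda>n. measure lborel (?T n))"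
    proof (rule summable_comparison_test')
      show "summable (\<lambda>n. C * enn2real ?P * (1/2 :: real) ^ n)"
        by (intro summable_mult summable_geometric) auto
      show "norm (measure lborel (?T n)) \<le> C * enn2real ?P * (1/2) ^ n" for n
        using C(1) enn2real_leI[OF _ T[of n]] by (simp add: measure_def)
    qed
  qed
  then show ?thesis
  proof eventually_elim
    case (elim x)
    then have T0: "eventually (\<lambda>n. x \<notin> ?T n) sequentially"
      by (auto elim: eventually_mono)
    have "eventually (\<lambda>n. x \<in> E \<longrightarrow> cube (site (e n) (cell_index (e n) x)) (e n / 2) \<subseteq> E) sequentially"
      using eventually_cell_subset[of x] by (cases "x \<in> E") auto
    with T0 show ?case
    proof eventually_elim
      case (elim n)
      show ?case
      proof (cases "interior_site R (e n) (cell_index (e n) x)")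
        case True
        then show ?thesis using elim(1) by blast
      next
        case False
        \<comment> \<open>A point outside \<open>E\<close> prevents its own cell from lying in
          \<open>E\<close>; for a point of \<open>E\<close> the cell is eventually contained in
          \<open>E\<close>.\<close>
        have "x \<in> cube (site (e n) (cell_index (e n) x)) (e n / 2)"
          using cell_subset_cube[OF e(1)[of n], of "cell_index (e n) x"] by (auto simp: cell_def)
        then show ?thesis
          using False elim(2) by (auto simp: lattice_approx_def)
      qed
    qed
  qed
qed

lemma eventually_not_mem_lattice_cube:
  assumes "x \<notin> cube 0 R"
  shows "eventually (\<lambda>n. x \<notin> lattice_cube R (e n)) sequentially"
proof -
  obtain m where m: "R < \<bar>x $ m\<bar>"
    using assms by (auto simp: cube_def not_le)
  then have "0 < \<bar>x $ m\<bar> - R" by simp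
  from eventually_mult_less[OF this, of "3 / 2"] show ?thesis
  proof eventually_elim
    case (elim n)
    then show ?case
      using lattice_cube_bound[OF e(1)[of n], of x R m] by linarith
  qed
qed

text \<open>Beyond the crossing of \<open>E\<close>, the approximation can separate only short pairs
  of interior cells (\<open>?near\<close>), pairs touching the boundary layer in their first or
  second point (\<open>S\<close>, \<open>S'\<close>), and pairs that are long or leave the cube
  (\<open>A\<close>). Each group costs at most \<eta>.\<close>

lemma approx_energy_le:
  assumes "0 < \<eta>"
  shows "eventually (\<lambda>n. emeasure \<nu> (crossing (lattice_cube R (e n)) (approx_region E R (e n)))
    \<le> emeasure \<nu> (crossing (cube 0 R) E) + ennreal (4 * \<eta>)) sequentially"
proof -
  let ?Q = "cube (0 :: real ^ 'd) R"
  obtain C1 where C1: "0 \<le> C1" "\<And>e. 0 < e \<Longrightarrow> e < 1 \<Longrightarrow>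
    emeasure \<nu> {(x, y). x \<in> lattice_cube R e - interior_cells R e \<and> cell_index e x \<noteq> cell_index e y}
      \<le> ennreal (C1 * e powr (1 - s))"
    using \<nu>_boundary_cells_le[OF R] by blast
  obtain C2 where C2: "0 \<le> C2" "\<And>n \<delta>. emeasure \<nu> (near_crossing (interior_cells R (e n)) (approx_region E R (e n)) \<delta>)
       \<le> ennreal C2 * emeasure \<nu> (near_crossing ?Q E (\<delta> + 2 * real CARD('d) * e n))"
  proof -
    from \<nu>_near_crossing_approx_le obtain C where "0 \<le> C" and C: "\<forall>E R e \<delta>. E \<in> sets borel \<longrightarrow> 0 < e \<longrightarrow>
      emeasure \<nu> (near_crossing (interior_cells R e) (approx_region E R e) \<delta>)
        \<le> ennreal C * emeasure \<nu> (near_crossing (cube 0 R) E (\<delta> + 2 * real CARD('d) * e))" by (elim exE conjE)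
    show ?thesis
      by (rule that[OF \<open>0 \<le> C\<close> C[rule_format, OF E_borel e(1)]])
  qed
  \<comment> \<open>Dividing by \<open>C2 + 1\<close> rather than \<open>C2\<close> covers
    \<open>C2 = 0\<close>. Only half of \<open>\<delta>'\<close> is used as \<delta>; the other half
    absorbs the widening \<open>2 * d * e n\<close>.\<close>
  obtain \<delta>' where \<delta>': "0 < \<delta>'" "emeasure \<nu> (near_crossing ?Q E \<delta>') < ennreal (\<eta> / (C2 + 1))"
    using near_crossing_small[OF E_borel fin, of "ennreal (\<eta> / (C2 + 1))"] assms C2(1) by auto
  define \<delta> where "\<delta> = \<delta>' / 2"
  have \<delta>: "0 < \<delta>" using \<delta>' by (simp add: \<delta>_def)
  let ?N = "{(x, y :: real ^ 'd). l1norm (x - y) < \<delta>}"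
  let ?near = "\<lambda>n. near_crossing (interior_cells R (e n)) (approx_region E R (e n)) \<delta>"
  define S :: "nat \<Rightarrow> ((real ^ 'd) \<times> (real ^ 'd)) set" where "S n = {(x, y). x \<in> lattice_cube R (e n) - interior_cells R (e n) \<and> cell_index (e n) x \<noteq> cell_index (e n) y}" for n
  define S' where "S' n = (\<lambda>p. (snd p, fst p)) -` S n" for n
  \<comment> \<open>With short pairs inside the cube removed, these sets lie in a fixed set of
    finite \<nu>-measure, and pointwise convergence of the approximations empties them.\<close>
  define A where "A n = crossing ?Q (approx_region E R (e n)) - crossing ?Q E - (?Q \<times> ?Q \<inter> ?N)" for n
  have N: "?N \<in> sets borel" by (rule near_borel)
  have A: "A n \<in> sets borel" for n
    unfolding A_def using N approx_region_borel[of n] by (intro sets.Diff sets.Int crossing_borel borel_Times) auto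
  have S: "S n \<in> sets borel" for n
  proof -
    have "S n = (\<Union>i\<in>discrete_cube R (e n) - Collect (interior_site R (e n)). cell (e n) i \<times> - cell (e n) i)"
      by (auto simp: S_def cell_def)
    also have "\<dots> \<in> sets borel"
      using finite_discrete_cube e(1)[of n] by (intro sets.finite_UN borel_Times) auto
    finally show ?thesis .
  qed
  have S': "S' n \<in> sets borel" for n
  proof -
    have "(\<lambda>p :: (real ^ 'd) \<times> (real ^ 'd). (snd p, fst p)) \<in> borel \<rightarrow>\<^sub>M borel"
      by (intro borel_measurable_continuous_onI continuous_intros)
    from measurable_sets[OF this S] show ?thesis by (simp add: S'_def)
  qed
  have near_ev: "eventually (\<lambda>n. emeasure \<nu> (?near n) \<le> ennreal \<eta>) sequentially"
  proof -
    from eventually_mult_less[OF \<delta>, of "2 * real CARD('d)"] show ?thesis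
    proof eventually_elim
      case (elim n)
      have "emeasure \<nu> (?near n) \<le> ennreal C2 * emeasure \<nu> (near_crossing ?Q E (\<delta> + 2 * real CARD('d) * e n))"
        by (rule C2(2))
      also have "\<dots> \<le> ennreal C2 * emeasure \<nu> (near_crossing ?Q E \<delta>')"
        using elim by (intro mult_left_mono emeasure_mono near_crossing_mono) (auto simp: \<delta>_def)
      also have "\<dots> \<le> ennreal C2 * ennreal (\<eta> / (C2 + 1))"
        using \<delta>'(2) by (intro mult_left_mono) auto
      also have "\<dots> = ennreal (C2 * (\<eta> / (C2 + 1)))"
        using C2(1) assms by (intro ennreal_mult[symmetric]) auto
      also have "\<dots> \<le> ennreal \<eta>"
        using C2(1) assms by (intro ennreal_leI) (simp add: field_simps)
      finally show ?case .
    qed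
  qed
  have S_ev: "eventually (\<lambda>n. emeasure \<nu> (S n) \<le> ennreal \<eta>) sequentially"
  proof -
    have "((\<lambda>n. e n powr (1 - s)) \<longlongrightarrow> 0 powr (1 - s)) sequentially"
      using s e(1) by (intro tendsto_powr' e0 tendsto_const) (auto intro!: always_eventually less_imp_le)
    then have "(\<lambda>n. C1 * e n powr (1 - s)) \<longlonglongrightarrow> 0"
      by (intro tendsto_mult_right_zero) simp
    then have "eventually (\<lambda>n. C1 * e n powr (1 - s) < \<eta>) sequentially"
      by (rule order_tendstoD(2)) (rule assms)
    then show ?thesis
    proof eventually_elim
      case (elim n)
      then show ?case
        unfolding S_def using C1(2)[OF e(1)[of n] e(2)[of n]] by (elim order_trans) (intro ennreal_leI, simp)
    qed
  qed
  have A_ev: "eventually (\<lambda>n. emeasure \<nu> (A n) \<le> ennreal \<eta>) sequentially"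
  proof -
    let ?Z = "(?Q \<times> ?Q - ?N) \<union> (?Q \<times> - ?Q \<union> (- ?Q) \<times> ?Q)"
    have Z: "?Q \<times> ?Q - ?N \<in> sets borel" "?Q \<times> - ?Q \<union> (- ?Q) \<times> ?Q \<in> sets borel"
      using N by (intro sets.Diff sets.Un borel_Times; auto)+
    have "(\<lambda>n. emeasure \<nu> (A n)) \<longlonglongrightarrow> 0"
    proof (rule emeasure_tendsto_0_if_eventually_not_mem[of ?Z])
      have "emeasure \<nu> ?Z \<le> emeasure \<nu> (?Q \<times> ?Q - ?N) + emeasure \<nu> (?Q \<times> - ?Q \<union> (- ?Q) \<times> ?Q)"
        using Z by (intro emeasure_subadditive) auto
      also have "\<dots> < \<infinity>"
        using \<nu>_far_finite[of R \<delta>] \<nu>_cube_boundary_finite[OF R] R \<delta> by simp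
      finally show "emeasure \<nu> ?Z < \<infinity>" .
      show "A n \<subseteq> ?Z" for n
        by (auto simp: A_def crossing_def)
      show "AE p in \<nu>. eventually (\<lambda>n. p \<notin> A n) sequentially"
        using AE_\<nu>[OF approx_converges]
      proof eventually_elim
        case (elim p)
        then have "eventually (\<lambda>n. fst p \<in> approx_region E R (e n) \<longleftrightarrow> fst p \<in> E) sequentially"
          "eventually (\<lambda>n. snd p \<in> approx_region E R (e n) \<longleftrightarrow> snd p \<in> E) sequentially" by auto
        then show ?case
        proof eventually_elim
          case (elim n)
          show ?case
            using crossing_cong[OF elim] by (simp add: A_def)
        qed
      qed
    qed (use A Z in auto)
    then have "eventually (\<lambda>n. emeasure \<nu> (A n) < ennreal \<eta>) sequentially"
      by (rule order_tendstoD(2)) (use assms in simp)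
    then show ?thesis
      by (auto elim: eventually_mono)
  qed
  have cover: "crossing (lattice_cube R (e n)) (approx_region E R (e n))
      \<subseteq> crossing ?Q E \<union> ?near n \<union> S n \<union> S' n \<union> A n" for n
  proof clarify
    fix x y
    assume xy: "(x, y) \<in> crossing (lattice_cube R (e n)) (approx_region E R (e n))"
      and not: "(x, y) \<notin> A n" "(x, y) \<notin> S' n" "(x, y) \<notin> S n" "(x, y) \<notin> ?near n"
    have neq: "cell_index (e n) x \<noteq> cell_index (e n) y"
      using xy by (auto simp: crossing_def)
    \<comment> \<open>Off the boundary layer the larger lattice cube reduces to interior cells,
      hence to the cube itself.\<close>
    have x: "x \<in> lattice_cube R (e n) \<Longrightarrow> x \<in> interior_cells R (e n)"
      using not(3) neq by (auto simp: S_def)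
    have y: "y \<in> lattice_cube R (e n) \<Longrightarrow> y \<in> interior_cells R (e n)"
      using not(2) neq by (auto simp: S_def S'_def)
    have sub: "interior_cells R (e n) \<subseteq> ?Q" "?Q \<subseteq> lattice_cube R (e n)"
      using interior_cells_subset cube_subset_lattice_cube e(1) by blast+
    have "(x, y) \<in> crossing ?Q (approx_region E R (e n))"
      using xy x y sub unfolding crossing_def by blast
    moreover have "(x, y) \<notin> ?Q \<times> ?Q \<inter> ?N"
      using not(4) xy x y sub unfolding near_crossing_def crossing_def by blast
    ultimately show "(x, y) \<in> crossing ?Q E"
      using not(1) unfolding A_def by blast
  qed
  have cQ: "crossing ?Q E \<in> sets borel" and nQ: "?near n \<in> sets borel" for n
    by auto
  have "eventually (\<lambda>n. emeasure \<nu> (crossing ?Q E \<union> ?near n \<union> S n \<union> S' n \<union> A n)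
      \<le> emeasure \<nu> (crossing ?Q E) + ennreal (4 * \<eta>)) sequentially"
    using near_ev S_ev A_ev
  proof eventually_elim
    case (elim n)
    have S'le: "emeasure \<nu> (S' n) \<le> ennreal \<eta>"
      unfolding S'_def using elim(2) emeasure_\<nu>_swap[OF S[of n]] by simp
    have "emeasure \<nu> (crossing ?Q E \<union> ?near n \<union> S n \<union> S' n \<union> A n)
        \<le> emeasure \<nu> (crossing ?Q E) + emeasure \<nu> (?near n) + emeasure \<nu> (S n) + emeasure \<nu> (S' n) + emeasure \<nu> (A n)"
      using cQ nQ[of n] S[of n] S'[of n] A[of n]
      by (intro order_trans[OF emeasure_subadditive] add_mono order_refl) (auto intro!: sets.Un)
    also have "\<dots> \<le> emeasure \<nu> (crossing ?Q E) + ennreal \<eta> + ennreal \<eta> + ennreal \<eta> + ennreal \<eta>"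
      by (intro add_mono order_refl elim S'le)
    also have "\<dots> = emeasure \<nu> (crossing ?Q E) + ennreal (4 * \<eta>)"
      using assms by (simp add: ennreal_plus[symmetric] add.assoc del: ennreal_plus)
    finally show ?case .
  qed
  then show ?thesis
  proof eventually_elim
    case (elim n)
    have "crossing ?Q E \<union> ?near n \<union> S n \<union> S' n \<union> A n \<in> sets \<nu>"
      using cQ nQ[of n] S[of n] S'[of n] A[of n] by (auto intro!: sets.Un)
    from emeasure_mono[OF cover this] elim show ?case
      by (rule order_trans)
  qed
qed

text \<open>Replacing \<open>F n\<close> by \<open>E\<close> outside the cube alters separation only
  for pairs in \<open>B n\<close>. A fixed exterior point eventually leaves the lattice cubes, where
  \<open>F n\<close> was free; from then on \<open>F n\<close> follows the approximation, which
  converges. So the \<nu>-measure of \<open>B n\<close> vanishes and costs one more \<eta>.\<close>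

lemma glued_energy_le:
  assumes F: "\<And>n. F n \<in> sets borel" "\<And>n x. x \<notin> lattice_cube R (e n) \<Longrightarrow> x \<in> F n \<longleftrightarrow> x \<in> approx_region E R (e n)"
    and le: "\<And>n. emeasure \<nu> (crossing (lattice_cube R (e n)) (F n))
      \<le> emeasure \<nu> (crossing (lattice_cube R (e n)) (approx_region E R (e n)))"
    and \<eta>: "0 < \<eta>"
  shows "eventually (\<lambda>n. emeasure \<nu> (crossing (cube 0 R) (F n \<inter> cube 0 R \<union> (E - cube 0 R)))
    \<le> emeasure \<nu> (crossing (cube 0 R) E) + ennreal (5 * \<eta>)) sequentially"
proof -
  let ?Q = "cube (0 :: real ^ 'd) R"
  define U where "U n = (F n - E \<union> (E - F n)) - ?Q" for n
  define B where "B n = ?Q \<times> U n \<union> U n \<times> ?Q" for n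
  have U: "U n \<in> sets borel" for n
    unfolding U_def using F(1) by auto
  have B: "B n \<in> sets borel" for n
    unfolding B_def using U by (intro sets.Un borel_Times) auto
  have "(\<lambda>n. emeasure \<nu> (B n)) \<longlonglongrightarrow> 0"
  proof (rule emeasure_tendsto_0_if_eventually_not_mem[of "?Q \<times> - ?Q \<union> (- ?Q) \<times> ?Q"])
    show "emeasure \<nu> (?Q \<times> - ?Q \<union> (- ?Q) \<times> ?Q) < \<infinity>"
      by (rule \<nu>_cube_boundary_finite[OF R])
    show "B n \<subseteq> ?Q \<times> - ?Q \<union> (- ?Q) \<times> ?Q" for n
      by (auto simp: B_def U_def)
    have ev: "eventually (\<lambda>n. x \<notin> U n) sequentially"
      if x: "eventually (\<lambda>n. x \<in> approx_region E R (e n) \<longleftrightarrow> x \<in> E) sequentially" for x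
    proof (cases "x \<in> ?Q")
      case True
      then show ?thesis by (simp add: U_def)
    next
      case False
      from x eventually_not_mem_lattice_cube[OF False] show ?thesis
      proof eventually_elim
        case (elim n)
        then show ?case using F(2)[of x n] by (simp add: U_def)
      qed
    qed
    show "AE p in \<nu>. eventually (\<lambda>n. p \<notin> B n) sequentially"
      using AE_\<nu>[OF approx_converges]
    proof eventually_elim
      case (elim p)
      then have "eventually (\<lambda>n. fst p \<notin> U n) sequentially" "eventually (\<lambda>n. snd p \<notin> U n) sequentially"
        using ev by auto
      then show ?case
        by eventually_elim (cases p, simp add: B_def)
    qed
  qed (use B in \<open>auto intro!: sets.Un borel_Times\<close>)
  then have "eventually (\<lambda>n. emeasure \<nu> (B n) < ennreal \<eta>) sequentially"
    by (rule order_tendstoD(2)) (use \<eta> in simp)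
  with approx_energy_le[OF \<eta>] show ?thesis
  proof eventually_elim
    case (elim n)
    let ?G = "F n \<inter> ?Q \<union> (E - ?Q)"
    have c: "crossing (lattice_cube R (e n)) (F n) \<in> sets \<nu>"
      using F(1)[of n] lattice_cube_borel[of n] by (simp add: crossing_borel)
    have "crossing ?Q ?G \<subseteq> crossing (lattice_cube R (e n)) (F n) \<union> B n"
    proof clarify
      fix x y assume xy: "(x, y) \<in> crossing ?Q ?G" "(x, y) \<notin> B n"
      have "?Q \<subseteq> lattice_cube R (e n)"
        by (rule cube_subset_lattice_cube[OF e(1)])
      moreover have "x \<in> ?G \<longleftrightarrow> x \<in> F n" "y \<in> ?G \<longleftrightarrow> y \<in> F n"
        using xy by (auto simp: crossing_def B_def U_def)
      ultimately show "(x, y) \<in> crossing (lattice_cube R (e n)) (F n)"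
        using xy(1) unfolding crossing_def by blast
    qed
    then have "emeasure \<nu> (crossing ?Q ?G) \<le> emeasure \<nu> (crossing (lattice_cube R (e n)) (F n) \<union> B n)"
      using B[of n] c by (intro emeasure_mono) auto
    also have "\<dots> \<le> emeasure \<nu> (crossing (lattice_cube R (e n)) (F n)) + emeasure \<nu> (B n)"
      using B[of n] c by (intro emeasure_subadditive) auto
    also have "\<dots> \<le> (emeasure \<nu> (crossing ?Q E) + ennreal (4 * \<eta>)) + ennreal \<eta>"
      using elim by (intro add_mono order_trans[OF le]) auto
    also have "\<dots> = emeasure \<nu> (crossing ?Q E) + ennreal (5 * \<eta>)"
      using \<eta> by (simp add: ennreal_plus[symmetric] add.assoc del: ennreal_plus)
    finally show ?case .
  qed
qed

end

section \<open>Reduction to a Borel kernel and conclusion\<close>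

lemma AE_lborel_swap:
  fixes P :: "'a::euclidean_space \<times> 'a \<Rightarrow> bool"
  assumes "AE p in lborel. P p"
  shows "AE p in lborel. P (snd p, fst p)"
proof -
  have "AE p in distr (lborel \<Otimes>\<^sub>M lborel) (lborel \<Otimes>\<^sub>M lborel) (\<lambda>(x, y). (y, x)). P p"
    unfolding lborel_pair.distr_pair_swap[symmetric, where ?'a = 'a and ?'b = 'a] using assms by (simp only: lborel_prod)
  then have "AE p in lborel \<Otimes>\<^sub>M lborel. P (case p of (x, y) \<Rightarrow> (y, x))"
    by (rule AE_distrD[rotated]) measurable
  then show ?thesis
    unfolding lborel_prod by (simp add: case_prod_beta)
qed

text \<open>A Borel version \<open>g\<close> of \<open>K\<close> is symmetrised by a maximum with
  its swap and then clamped between the two power bounds. Where (K1), (K2) and \<open>K = g\<close>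
  hold at a pair, and \<open>K = g\<close> also at the swapped pair, this changes nothing.\<close>

lemma kernel_ok_borel_version:
  fixes K :: "real ^ 'd \<Rightarrow> real ^ 'd \<Rightarrow> ennreal"
  assumes "kernel_ok K s lam Lam"
  obtains k where "fractional_kernel k s lam Lam"
    "\<And>A B. A \<in> sets borel \<Longrightarrow> B \<in> sets borel \<Longrightarrow> L_K K A B = emeasure (fractional_kernel.\<nu> k) (A \<times> B)"
proof -
  let ?h = "\<lambda>c p. ennreal (c * l1norm (fst p - snd p :: real ^ 'd) powr (- (real CARD('d) + s)))"
  have ok: "0 < s" "s < 1" "0 < lam" "lam \<le> Lam"
    and meas: "(\<lambda>p. K (fst p) (snd p)) \<in> borel_measurable (completion (lborel \<Otimes>\<^sub>M lborel))"
    and sym: "AE p in lborel. K (fst p) (snd p) = K (snd p) (fst p)"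
    and bounds: "AE p in lborel. ?h lam p \<le> K (fst p) (snd p) \<and> K (fst p) (snd p) \<le> ?h Lam p"
    using assms unfolding kernel_ok_def AE_completion_iff lborel_prod by blast+
  obtain g where g: "g \<in> borel_measurable (lborel \<Otimes>\<^sub>M lborel)" and "AE p in lborel \<Otimes>\<^sub>M lborel. K (fst p) (snd p) = g p"
    using completion_ex_borel_measurable[OF meas] by blast
  then have Kg: "AE p in lborel. K (fst p) (snd p) = g p"
    unfolding lborel_prod by simp
  have g' [measurable]: "g \<in> borel_measurable borel"
    using g unfolding lborel_prod by simp
  have [measurable]: "(\<lambda>p :: (real ^ 'd) \<times> (real ^ 'd). (snd p, fst p)) \<in> borel \<rightarrow>\<^sub>M borel"
    by (intro borel_measurable_continuous_onI continuous_intros)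
  have [measurable]: "(\<lambda>p :: (real ^ 'd) \<times> (real ^ 'd). fst p - snd p) \<in> borel \<rightarrow>\<^sub>M borel"
    by (intro borel_measurable_continuous_onI continuous_intros)
  define k where "k p = max (?h lam p) (min (?h Lam p) (max (g p) (g (snd p, fst p))))" for p
  have k_meas: "k \<in> borel_measurable borel"
    unfolding k_def by measurable
  have h_le: "?h lam p \<le> ?h Lam p" for p
    using ok by (intro ennreal_leI mult_right_mono) auto
  interpret fractional_kernel k s lam Lam
  proof
    show "k (x, y) = k (y, x)" for x y
      unfolding k_def by (simp add: l1norm_minus_commute[of x y] max.commute)
    show "ennreal (lam * l1norm (x - y) powr (- (real CARD('d) + s))) \<le> k (x, y)" for x y
      unfolding k_def by simp
    show "k (x, y) \<le> ennreal (Lam * l1norm (x - y) powr (- (real CARD('d) + s)))" for x y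
      unfolding k_def using h_le[of "(x, y)"] by simp
  qed (use ok k_meas in auto)
  have "AE p in lborel. K (fst p) (snd p) = k p"
    using Kg AE_lborel_swap[OF Kg] sym bounds
  proof eventually_elim
    case (elim p)
    then have "g (snd p, fst p) = K (fst p) (snd p)" "g p = K (fst p) (snd p)" by simp_all
    then show ?case
      using elim(4) unfolding k_def by simp
  qed
  \<comment> \<open>\<open>L_K\<close> is an iterated integral, so the almost everywhere equality is
    needed fibrewise.\<close>
  then have AE: "AE x in lborel. AE y in lborel. K x y = k (x, y)"
    unfolding lborel_prod[symmetric] by (drule_tac lborel_pair.AE_pair) simp
  have "L_K K A B = emeasure \<nu> (A \<times> B)" if [measurable]: "A \<in> sets borel" "B \<in> sets borel" for A B
  proof -
    have AB: "A \<times> B \<in> sets borel" by (intro borel_Times that)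
    have "L_K K A B = (\<integral>\<^sup>+x. (\<integral>\<^sup>+y. K x y * indicator B y \<partial>lborel) * indicator A x \<partial>lborel)"
      unfolding L_K_def nn_integral_completion ..
    also have "\<dots> = (\<integral>\<^sup>+x. \<integral>\<^sup>+y. k (x, y) * indicator (A \<times> B) (x, y) \<partial>lborel \<partial>lborel)"
    proof (rule nn_integral_cong_AE, use AE in eventually_elim)
      case (elim x)
      have "(\<integral>\<^sup>+y. K x y * indicator B y \<partial>lborel) = (\<integral>\<^sup>+y. k (x, y) * indicator B y \<partial>lborel)"
        using elim by (intro nn_integral_cong_AE) (auto elim: eventually_mono)
      then show ?case
        by (cases "x \<in> A") (auto simp: indicator_times)
    qed
    also have "\<dots> = (\<integral>\<^sup>+p. k p * indicator (A \<times> B) p \<partial>(lborel \<Otimes>\<^sub>M lborel))"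
      using AB k_meas by (intro lborel.nn_integral_fst) (auto simp: borel_prod lborel_prod)
    also have "\<dots> = emeasure \<nu> (A \<times> B)"
      unfolding lborel_prod \<nu>_def using AB k_meas by (intro emeasure_density[symmetric]) auto
    finally show ?thesis .
  qed
  then show ?thesis
    by (rule that[OF fractional_kernel_axioms])
qed

text \<open>The three terms of \<open>Per_K\<close> measure disjoint sets of pairs whose first point
  is in \<open>F\<close> and whose second is not. Together they form half of the crossing set; the
  other half is their mirror image, of equal \<nu>-measure.\<close>

lemma (in fractional_kernel) crossing_eq_Per_K:
  assumes LK: "\<And>A B. A \<in> sets borel \<Longrightarrow> B \<in> sets borel \<Longrightarrow> L_K K A B = emeasure \<nu> (A \<times> B)"
    and F: "F \<in> sets borel" and Q: "Q \<in> sets borel"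
  shows "emeasure \<nu> (crossing Q F) = 2 * Per_K K F Q"
proof -
  define X Y Z where "X = (F \<inter> Q) \<times> (Q - F)" and "Y = (F \<inter> Q) \<times> (UNIV - (F \<union> Q))" and "Z = (F - Q) \<times> (Q - F)"
  have XYZ: "X \<in> sets \<nu>" "Y \<in> sets \<nu>" "Z \<in> sets \<nu>"
    unfolding X_def Y_def Z_def using F Q by (auto intro!: borel_Times)
  let ?W = "X \<union> Y \<union> Z" and ?s = "\<lambda>p :: (real ^ 'd) \<times> (real ^ 'd). (snd p, fst p)"
  have W: "?W \<in> sets borel" using XYZ by auto
  have "?s \<in> borel \<rightarrow>\<^sub>M borel"
    by (intro borel_measurable_continuous_onI continuous_intros)
  from measurable_sets[OF this W] have W': "?s -` ?W \<in> sets borel" by simp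
  have "emeasure \<nu> ?W = emeasure \<nu> (X \<union> Y) + emeasure \<nu> Z"
    using XYZ by (intro plus_emeasure[symmetric]) (auto simp: X_def Y_def Z_def)
  also have "emeasure \<nu> (X \<union> Y) = emeasure \<nu> X + emeasure \<nu> Y"
    using XYZ by (intro plus_emeasure[symmetric]) (auto simp: X_def Y_def)
  finally have PerW: "emeasure \<nu> ?W = Per_K K F Q"
    unfolding Per_K_def X_def Y_def Z_def using F Q by (simp add: LK)
  have "crossing Q F = ?W \<union> ?s -` ?W"
    by (auto simp: crossing_def X_def Y_def Z_def)
  also have "emeasure \<nu> \<dots> = emeasure \<nu> ?W + emeasure \<nu> (?s -` ?W)"
    using W W' by (intro plus_emeasure[symmetric]) (auto simp: X_def Y_def Z_def)
  also have "\<dots> = 2 * Per_K K F Q"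
    using emeasure_\<nu>_swap[OF W] PerW by (simp add: mult_2)
  finally show ?thesis .
qed

section \<open>Convergence of the discrete minimizers\<close>

theorem theorem1p4:
  fixes K :: "real ^ 'd \<Rightarrow> real ^ 'd \<Rightarrow> ennreal"
    and s lam Lam R :: real
    and E :: "(real ^ 'd) set"
    and eps :: "nat \<Rightarrow> real"
  assumes "CARD('d) \<ge> 2"
    and "kernel_ok K s lam Lam"
    and "open E"
    and "R \<ge> 1"
    and "strict_minimizer K E (cube 0 R)"
    and "\<And>n. 0 < eps n \<and> eps n < 1"
    and "eps \<longlonglongrightarrow> 0"
  shows "\<exists>u :: nat \<Rightarrow> (int ^ 'd \<Rightarrow> int).
           (\<forall>n. is_minimizer K s (eps n) (discrete_cube R (eps n)) (u n)) \<and>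
           (\<exists>nk :: nat \<Rightarrow> nat. filterlim nk at_top sequentially \<and>
              (AE x in lebesgue.
                 (\<lambda>k. real_of_int (extension (eps (nk k)) (u (nk k)) x))
                   \<longlonglongrightarrow> (if x \<in> E then 1 else -1)))"
proof -
  let ?Q = "cube (0 :: real ^ 'd) R"
  obtain k where "fractional_kernel k s lam Lam"
    and LK: "\<And>A B. A \<in> sets borel \<Longrightarrow> B \<in> sets borel \<Longrightarrow> L_K K A B = emeasure (fractional_kernel.\<nu> k) (A \<times> B)"
    using kernel_ok_borel_version[OF assms(2)] by blast
  then interpret fractional_kernel k s lam Lam by simp
  have E: "E \<in> sets borel" using assms(3) by (rule borel_open)
  have Per: "emeasure \<nu> (crossing Q F) = 2 * Per_K K F Q" if "F \<in> sets borel" "Q \<in> sets borel" for F Q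
    by (intro crossing_eq_Per_K LK that)
  have PerE: "Per_K K E ?Q < \<infinity>"
    and strict: "\<And>F. F \<in> sets lebesgue \<Longrightarrow> F - ?Q = E - ?Q \<Longrightarrow> emeasure lebesgue (F - E \<union> (E - F)) \<noteq> 0
      \<Longrightarrow> Per_K K E ?Q < Per_K K F ?Q"
    using assms(5) unfolding strict_minimizer_def by blast+
  have fin: "emeasure \<nu> (crossing ?Q E) < \<infinity>"
    using PerE by (simp add: Per[OF E] ennreal_mult_less_top)
  have AE_eq: "AE x in lborel. x \<in> F \<longleftrightarrow> x \<in> E"
    if F: "F \<in> sets borel" and null: "emeasure lebesgue (F - E \<union> (E - F)) = 0" for F
  proof (rule AE_I')
    show "F - E \<union> (E - F) \<in> null_sets lborel"
      using F E null by (auto simp: null_sets_def)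
  qed auto
  have less: "emeasure \<nu> (crossing ?Q E) < emeasure \<nu> (crossing ?Q F)"
    if F: "F \<in> sets borel" "F - ?Q = E - ?Q" and "emeasure lebesgue (F - E \<union> (E - F)) \<noteq> 0" for F
  proof -
    have "F \<in> sets lebesgue" using F(1) by simp
    from strict[OF this F(2) that(3)] show ?thesis
      unfolding Per[OF E cube_borel] Per[OF F(1) cube_borel]
      by (intro ennreal_mult_strict_left_mono) auto
  qed
  \<comment> \<open>Strict minimality compares only sets differing by positive measure; a null
    modification of \<open>E\<close> has the same perimeter, so minimality extends to all
    competitors.\<close>
  have min: "emeasure \<nu> (crossing ?Q E) \<le> emeasure \<nu> (crossing ?Q F)"
    if F: "F \<in> sets borel" "F - ?Q = E - ?Q" for F
  proof (cases "emeasure lebesgue (F - E \<union> (E - F)) = 0")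
    case False
    then show ?thesis using less[OF F] by simp
  next
    case True
    have "emeasure \<nu> (crossing ?Q E) = emeasure \<nu> (crossing ?Q F)"
    proof (rule emeasure_eq_AE)
      show "AE p in \<nu>. p \<in> crossing ?Q E \<longleftrightarrow> p \<in> crossing ?Q F"
        using AE_\<nu>[OF AE_eq[OF F(1) True]] by eventually_elim (intro crossing_cong, auto)
    qed (use E F in auto)
    then show ?thesis by simp
  qed
  have strict': "AE x in lborel. x \<in> F \<longleftrightarrow> x \<in> E"
    if F: "F \<in> sets borel" "F - ?Q = E - ?Q" "emeasure \<nu> (crossing ?Q F) \<le> emeasure \<nu> (crossing ?Q E)" for F
    using AE_eq[OF F(1)] less[OF F(1,2)] F(3) by force
  have eps: "0 < eps n" "eps n < 1" for n using assms(6) by auto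

  \<comment> \<open>Minimizers are fixed for every n before any extraction, with the lattice
    approximation as exterior data.\<close>
  have "\<exists>u. is_minimizer K s (eps n) (discrete_cube R (eps n)) u
      \<and> (\<forall>i. i \<notin> discrete_cube R (eps n) \<longrightarrow> u i = lattice_approx E R (eps n) i)" for n
    using minimizer_exists[OF finite_discrete_cube configuration_lattice_approx] by metis
  then obtain u where u: "\<And>n. is_minimizer K s (eps n) (discrete_cube R (eps n)) (u n)"
    and u_ext: "\<And>n i. i \<notin> discrete_cube R (eps n) \<Longrightarrow> u n i = lattice_approx E R (eps n) i"
    by metis
  define F where "F n = {x. u n (cell_index (eps n) x) = 1}" for n
  have F: "F n \<in> sets borel" for n
    unfolding F_def using eps(1) by (rule Collect_cell_index_borel)
  have F_ext: "x \<in> F n \<longleftrightarrow> x \<in> approx_region E R (eps n)" if "x \<notin> lattice_cube R (eps n)" for x n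
    using that by (simp add: F_def u_ext)
  have F_le: "emeasure \<nu> (crossing (lattice_cube R (eps n)) (F n))
      \<le> emeasure \<nu> (crossing (lattice_cube R (eps n)) (approx_region E R (eps n)))" for n
  proof -
    let ?c = "ennreal (2 * eps n powr (s - real CARD('d)))"
    have H_eq: "H_energy K s (eps n) (discrete_cube R (eps n)) w
        = ?c * emeasure \<nu> (crossing (lattice_cube R (eps n)) {x. w (cell_index (eps n) x) = 1})" if "configuration w" for w
      by (intro H_energy_eq LK that eps)
    have conf: "configuration (u n)"
      using u[of n] by (simp add: is_minimizer_def)
    have "H_energy K s (eps n) (discrete_cube R (eps n)) (u n)
        \<le> H_energy K s (eps n) (discrete_cube R (eps n)) (lattice_approx E R (eps n))"
      using u[of n] u_ext[of _ n] configuration_lattice_approx[of E R "eps n"] unfolding is_minimizer_def by simp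
    then have "?c * emeasure \<nu> (crossing (lattice_cube R (eps n)) (F n))
        \<le> ?c * emeasure \<nu> (crossing (lattice_cube R (eps n)) (approx_region E R (eps n)))"
      unfolding F_def
      by (simp only: H_eq[OF conf] H_eq[OF configuration_lattice_approx])
    moreover have "0 < ?c" "?c < top"
      using eps(1)[of n] by auto
    ultimately show ?thesis
      by (simp add: ennreal_mult_le_mult_iff)
  qed

  \<comment> \<open>First extraction: the mesh decreases fast enough for Borel-Cantelli.\<close>
  have "\<exists>m\<ge>n. eps m powr s \<le> (1/2) ^ n" for n :: nat
  proof -
    have "(\<lambda>m. eps m powr s) \<longlonglongrightarrow> 0 powr s"
      using s eps(1) by (intro tendsto_powr' assms(7) tendsto_const) (auto intro!: always_eventually less_imp_le)
    then have "eventually (\<lambda>m. eps m powr s < (1/2) ^ n) sequentially"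
      by (intro order_tendstoD(2)) auto
    then show ?thesis
      unfolding eventually_sequentially by (meson less_imp_le nle_le)
  qed
  then obtain r where r: "\<And>n. n \<le> r n" "\<And>n. eps (r n) powr s \<le> (1/2) ^ n"
    by metis
  have r_top: "filterlim r at_top sequentially"
    by (rule filterlim_at_top_mono[OF filterlim_ident]) (use r in auto)
  interpret lattice_sequence k s lam Lam E R "\<lambda>n. eps (r n)"
  proof
    show "(\<lambda>n. eps (r n)) \<longlonglongrightarrow> 0"
      by (rule filterlim_compose[OF assms(7) r_top])
  qed (use assms fin eps r in auto)

  \<comment> \<open>Unlike \<open>F (r n)\<close>, this set agrees with \<open>E\<close> outside the
    cube and is an admissible competitor.\<close>
  define G where "G n = F (r n) \<inter> ?Q \<union> (E - ?Q)" for n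
  \<comment> \<open>Second extraction: the excess becomes summable. The division by 5 compensates
    the five error terms of \<open>glued_energy_le\<close>.\<close>
  have "\<exists>m\<ge>j. emeasure \<nu> (crossing ?Q (G m)) \<le> emeasure \<nu> (crossing ?Q E) + ennreal ((1/2) ^ j)" for j :: nat
  proof -
    have "eventually (\<lambda>n. emeasure \<nu> (crossing ?Q (G n)) \<le> emeasure \<nu> (crossing ?Q E) + ennreal (5 * ((1/2) ^ j / 5))) sequentially"
      unfolding G_def by (rule glued_energy_le) (use F F_ext F_le in auto)
    then have "eventually (\<lambda>n. emeasure \<nu> (crossing ?Q (G n)) \<le> emeasure \<nu> (crossing ?Q E) + ennreal ((1/2) ^ j)) sequentially"
      by simp
    then show ?thesis
      unfolding eventually_sequentially by (meson nle_le)
  qed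
  then obtain q where q: "\<And>j. j \<le> q j"
    "\<And>j. emeasure \<nu> (crossing ?Q (G (q j))) \<le> emeasure \<nu> (crossing ?Q E) + ennreal ((1/2) ^ j)"
    by metis
  have q_top: "filterlim q at_top sequentially"
    by (rule filterlim_at_top_mono[OF filterlim_ident]) (use q in auto)
  have "AE x in lborel. eventually (\<lambda>j. x \<in> G (q j) \<longleftrightarrow> x \<in> E) sequentially"
  proof (rule near_minimizers_converge[OF sets_\<nu> E cube_borel fin])
    show "G (q j) \<in> sets borel" for j
      unfolding G_def using F E by auto
    show "G (q j) - ?Q = E - ?Q" for j
      by (auto simp: G_def)
  qed (fact min strict' q)+
  moreover have "AE x in lborel. \<forall>n u. extension (eps n) u x = u (cell_index (eps n) x)"
    unfolding AE_all_countable using AE_extension_eq[OF eps(1)] by blast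
  ultimately have "AE x in lborel. (\<lambda>j. real_of_int (extension (eps (r (q j))) (u (r (q j))) x))
      \<longlonglongrightarrow> (if x \<in> E then 1 else -1)"
    using approx_converges
  proof eventually_elim
    case (elim x)
    have "eventually (\<lambda>j. x \<in> F (r (q j)) \<longleftrightarrow> x \<in> E) sequentially"
    proof (cases "x \<in> ?Q")
      case True
      then show ?thesis
        using elim(1) by (simp add: G_def)
    next
      case False
      \<comment> \<open>Outside the cube the glued sets carry no information on the minimizers;
        there the minimizers eventually coincide with the approximation at \<open>x\<close>.\<close>
      have "eventually (\<lambda>n. x \<in> F (r n) \<longleftrightarrow> x \<in> E) sequentially"
        using elim(3) eventually_not_mem_lattice_cube[OF False]
      proof eventually_elim
        case (elim n)
        then show ?case using F_ext by blast
      qed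
      then show ?thesis
        using q_top by (rule eventually_compose_filterlim)
    qed
    then have "eventually (\<lambda>j. real_of_int (extension (eps (r (q j))) (u (r (q j))) x) = (if x \<in> E then 1 else -1)) sequentially"
    proof eventually_elim
      case (elim j)
      let ?i = "cell_index (eps (r (q j))) x"
      have "u (r (q j)) ?i = -1 \<or> u (r (q j)) ?i = 1"
        using u[of "r (q j)"] by (simp add: is_minimizer_def configuration_def)
      moreover have "extension (eps (r (q j))) (u (r (q j))) x = u (r (q j)) ?i"
        using \<open>\<forall>n u. extension (eps n) u x = u (cell_index (eps n) x)\<close> by blast
      ultimately show ?case
        using elim by (auto simp: F_def)
    qed
    then show ?case
      by (rule tendsto_eventually)
  qed
  then have "AE x in lebesgue. (\<lambda>j. real_of_int (extension (eps (r (q j))) (u (r (q j))) x))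
      \<longlonglongrightarrow> (if x \<in> E then 1 else -1)"
    by (rule AE_completion)
  moreover have "filterlim (\<lambda>j. r (q j)) at_top sequentially"
    by (rule filterlim_compose[OF r_top q_top])
  ultimately show ?thesis
    using u by (intro exI[of _ u] conjI allI exI[of _ "\<lambda>j. r (q j)"])
qed

end
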